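(* Let $\Sigma$ be a germ at $0$ of a closed subset of $\mathbb{R}^n$ with $0\in\Sigma$, let $r$ be a positive integer, $n\ge p$, and $f\in\mathcal{E}_{[r+1]}(n,p)$. If $f$ satisfies the second relative Kuo condition $(K^\delta_\Sigma)$ — i.e. for every $g\in\mathcal{E}_{[r+1]}(n,p)$ with $j^rg(\Sigma;0)=j^rf(\Sigma;0)$ there are $C,\alpha,\delta,\bar w>0$ (depending on $g$) such that $\kappa(df(x))\ge C\,d(x,\Sigma)^{r-\delta}$ for all $x\in\mathcal{H}^\Sigma_{r+1}(g;\bar w)\cap\{\|x\|<\alpha\}$ — then $j^rf(\Sigma;0)$ is $\Sigma$-$V$-sufficient in $\mathcal{E}_{[r+1]}(n,p)$.
   Context: $\mathcal{E}_{[s]}(n,p)$ is the set of germs at $0$ of $C^s$ maps $(\mathbb{R}^n,0)\to(\mathbb{R}^p,0)$. $j^rg(\Sigma;0)=j^rf(\Sigma;0)$ means the $r$-jets of $f,g$ coincide at every point of $\Sigma\cap U$ for some neighbourhood $U$ of $0$. Two germs $f,g$ are $\Sigma$-$V$-equivalent if the germs at $0$ of $f^{-1}(0)$ and $g^{-1}(0)$ are homeomorphic by a homeomorphism fixing $f^{-1}(0)\cap\Sigma$ pointwise; the relative jet is $\Sigma$-$V$-sufficient in $\mathcal{E}_{[s]}(n,p)$ if any two of its realisations there are $\Sigma$-$V$-equivalent. $d(x,\Sigma)$ is the distance to $\Sigma$. $\kappa(df(x))=\min_i\operatorname{dist}(\operatorname{grad}f_i(x),\operatorname{span}\{\operatorname{grad}f_j(x):j\ne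 i\})$. $\mathcal{H}^\Sigma_{d}(g;\bar w)=\{x:\|g(x)\|\le\bar w\,d(x,\Sigma)^{d}\}$. *)

theory Defs
  imports "HOL-Analysis.Analysis"
begin

text \<open>C^k maps on an open set: C^0 = continuous; C^(k+1) = differentiable with every
  directional derivative x \<mapsto> Df(x) v of class C^k (equivalent to the usual notion
  in finite dimensions).\<close>
primrec Ck_on :: "nat \<Rightarrow> ('a::real_normed_vector \<Rightarrow> 'b::real_normed_vector) \<Rightarrow> 'a set \<Rightarrow> bool" where
  "Ck_on 0 f U = continuous_on U f"
| "Ck_on (Suc k) f U =
     (f differentiable_on U \<and> (\<forall>v. Ck_on k (\<lambda>x. frechet_derivative f (at x) v) U))"

definition germ_Cs :: "nat \<Rightarrow> (real^'n \<Rightarrow> real^'p) \<Rightarrow> bool" where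
  "germ_Cs s f \<longleftrightarrow> f 0 = 0 \<and> (\<exists>U. open U \<and> 0 \<in> U \<and> Ck_on s f U)"

fun dderiv :: "('a::real_normed_vector \<Rightarrow> 'b::real_normed_vector) \<Rightarrow> 'a list \<Rightarrow> 'a \<Rightarrow> 'b" where
  "dderiv f [] = f"
| "dderiv f (v # vs) = (\<lambda>x. frechet_derivative (dderiv f vs) (at x) v)"

definition jet_eq_at :: "nat \<Rightarrow> ('a::real_normed_vector \<Rightarrow> 'b::real_normed_vector) \<Rightarrow> ('a \<Rightarrow> 'b) \<Rightarrow> 'a \<Rightarrow> bool" where
  "jet_eq_at r f g x \<longleftrightarrow> (\<forall>vs. length vs \<le> r \<longrightarrow> dderiv f vs x = dderiv g vs x)"

definition rel_jet_eq :: "nat \<Rightarrow> 'a::real_normed_vector set \<Rightarrow> ('a \<Rightarrow> 'b::real_normed_vector) \<Rightarrow> ('a \<Rightarrow> 'b) \<Rightarrow> bool" where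
  "rel_jet_eq r \<Sigma> g f \<longleftrightarrow> (\<exists>U. open U \<and> 0 \<in> U \<and> (\<forall>x \<in> \<Sigma> \<inter> U. jet_eq_at r g f x))"

definition grad_comp :: "(real^'n \<Rightarrow> real^'p) \<Rightarrow> 'p \<Rightarrow> real^'n \<Rightarrow> real^'n" where
  "grad_comp f i x = (\<chi> k. frechet_derivative f (at x) (axis k 1) $ i)"

definition kappa :: "(real^'n \<Rightarrow> real^'p) \<Rightarrow> real^'n \<Rightarrow> real" where
  "kappa f x = Min (range (\<lambda>i. infdist (grad_comp f i x) (span {grad_comp f j x | j. j \<noteq> i})))"

definition horn :: "'a::metric_space set \<Rightarrow> nat \<Rightarrow> ('a \<Rightarrow> 'b::real_normed_vector) \<Rightarrow> real \<Rightarrow> 'a set" where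
  "horn \<Sigma> d g w = {x. norm (g x) \<le> w * infdist x \<Sigma> ^ d}"

definition rel_kuo_delta :: "(real^'n) set \<Rightarrow> nat \<Rightarrow> (real^'n \<Rightarrow> real^'p) \<Rightarrow> bool" where
  "rel_kuo_delta \<Sigma> r f \<longleftrightarrow>
     (\<forall>g. germ_Cs (Suc r) g \<and> rel_jet_eq r \<Sigma> g f \<longrightarrow>
        (\<exists>C \<alpha> \<delta> w. C > 0 \<and> \<alpha> > 0 \<and> \<delta> > 0 \<and> w > 0 \<and>
           (\<forall>x \<in> horn \<Sigma> (Suc r) g w \<inter> {x. norm x < \<alpha>}.
              kappa f x \<ge> C * infdist x \<Sigma> powr (real r - \<delta>))))"

definition sigma_V_equiv :: "'a::real_normed_vector set \<Rightarrow> ('a \<Rightarrow> 'b::real_normed_vector) \<Rightarrow> ('a \<Rightarrow> 'b) \<Rightarrow> bool" where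
  "sigma_V_equiv \<Sigma> f g \<longleftrightarrow>
     (\<exists>U V h k. open U \<and> 0 \<in> U \<and> open V \<and> 0 \<in> V \<and>
        homeomorphism (f -` {0} \<inter> U) (g -` {0} \<inter> V) h k \<and>
        (\<forall>x \<in> f -` {0} \<inter> \<Sigma> \<inter> U. h x = x))"

definition sigma_V_sufficient :: "(real^'n) set \<Rightarrow> nat \<Rightarrow> nat \<Rightarrow> (real^'n \<Rightarrow> real^'p) \<Rightarrow> bool" where
  "sigma_V_sufficient \<Sigma> r s f \<longleftrightarrow>
     (\<forall>g1 g2. germ_Cs s g1 \<and> rel_jet_eq r \<Sigma> g1 f \<and> germ_Cs s g2 \<and> rel_jet_eq r \<Sigma> g2 f
        \<longrightarrow> sigma_V_equiv \<Sigma> g1 g2)"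

end

theory Submission
  imports Defs
begin

text \<open>
  Let \<open>g1\<close>, \<open>g2\<close> be two realisations, \<open>F t = (1 - t) g1 + t g2\<close>, \<open>P = g2 - g1\<close>,
  \<open>A t = (1 - t) dg1 + t dg2\<close> and \<open>d = d(x, \<Sigma>)\<close>. By Taylor's formula \<open>P = O(d^(r+1))\<close> and
  \<open>A t - df = O(d^r)\<close>. Since each \<open>F t\<close> is itself a realisation, the Kuo condition and compactness of
  \<open>[0,1]\<close> give \<open>|A\<^sup>T v| \<ge> d^r |v|\<close> on a horn \<open>|F t| \<le> w d^(r+1)\<close> with \<open>w\<close> independent of \<open>t\<close>.

  The field \<open>X = - A\<^sup>T \<mu>\<close>, where \<open>(A A\<^sup>T + |F t|) \<mu> = P\<close>, is then \<open>O(d)\<close> inside and outside the horn and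
  Lipschitz away from \<open>\<Sigma>\<close>. By Gronwall's inequality its integral curves \<open>u\<close> never reach \<open>\<Sigma>\<close>, so that its
  time-one map is a homeomorphism near \<open>0\<close> fixing \<open>\<Sigma>\<close>. Along such a curve \<open>\<phi> t = F t (u t)\<close> satisfies
  \<open>\<phi>' = |\<phi>| \<mu>\<close>, hence the time-one map carries the zeros of \<open>g1\<close> to those of \<open>g2\<close>.
\<close>

section \<open>Gronwall's inequality and the Picard-Lindelof theorem\<close>

lemma exp_minus_mult_le_iff: "exp (- c) * a \<le> b \<longleftrightarrow> a \<le> exp c * b" for a b c :: real
  by (simp add: exp_minus field_simps)

lemma gronwall_derivative_ge:
  fixes f :: "real \<Rightarrow> real"
  assumes "a \<le> b"
    and deriv: "\<And>t. t \<in> {a..b} \<Longrightarrow> (f has_real_derivative f' t) (at t within {a..b})"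
    and ge: "\<And>t. t \<in> {a..b} \<Longrightarrow> c * f t \<le> f' t"
  shows "exp (c * (b - a)) * f a \<le> f b"
proof -
  let ?h = "\<lambda>t. exp (- c * t) * f t"
  have h_deriv: "(?h has_real_derivative exp (- c * t) * (f' t - c * f t)) (at t within {a..b})"
    if "t \<in> {a..b}" for t
    using deriv[OF that] by (auto intro!: derivative_eq_intros simp: algebra_simps)
  have "?h a \<le> ?h b"
  proof (rule DERIV_nonneg_imp_increasing_open[OF \<open>a \<le> b\<close>])
    show "continuous_on {a..b} ?h"
      by (rule DERIV_continuous_on[OF h_deriv])
    show "\<exists>y. DERIV ?h t :> y \<and> 0 \<le> y" if "a < t" "t < b" for t
      using h_deriv[of t] ge[of t] that by (auto simp: at_within_Icc_at intro!: exI)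
  qed
  then show ?thesis
    by (simp add: exp_diff exp_minus field_simps)
qed

lemma gronwall_derivative_le:
  fixes f :: "real \<Rightarrow> real"
  assumes "a \<le> b"
    and deriv: "\<And>t. t \<in> {a..b} \<Longrightarrow> (f has_real_derivative f' t) (at t within {a..b})"
    and le: "\<And>t. t \<in> {a..b} \<Longrightarrow> f' t \<le> c * f t"
  shows "f b \<le> exp (c * (b - a)) * f a"
  using gronwall_derivative_ge[of a b "\<lambda>t. - f t" "\<lambda>t. - f' t" c, OF assms(1) DERIV_minus[OF deriv]] le
  by auto

lemma gronwall_abs:
  fixes f :: "real \<Rightarrow> real"
  assumes deriv: "\<And>t. t \<in> {a..b} \<Longrightarrow> (f has_real_derivative f' t) (at t within {a..b})"
    and le: "\<And>t. t \<in> {a..b} \<Longrightarrow> \<bar>f' t\<bar> \<le> c * f t"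
    and s: "s \<in> {a..b}" and t: "t \<in> {a..b}"
  shows "f t \<le> exp (c * \<bar>t - s\<bar>) * f s"
proof (cases "s \<le> t")
  case True
  have sub: "{s..t} \<subseteq> {a..b}"
    using s t by auto
  have "f t \<le> exp (c * (t - s)) * f s"
  proof (rule gronwall_derivative_le[OF True])
    fix q assume "q \<in> {s..t}"
    then have q: "q \<in> {a..b}"
      using sub by auto
    show "(f has_real_derivative f' q) (at q within {s..t})"
      by (rule DERIV_subset[OF deriv[OF q] sub])
    show "f' q \<le> c * f q"
      using le[OF q] by linarith
  qed
  then show ?thesis
    using True by simp
next
  case False
  then have "t \<le> s" and sub: "{t..s} \<subseteq> {a..b}"
    using s t by auto
  have "exp (- c * (s - t)) * f t \<le> f s"
  proof (rule gronwall_derivative_ge[OF \<open>t \<le> s\<close>])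
    fix q assume "q \<in> {t..s}"
    then have q: "q \<in> {a..b}"
      using sub by auto
    show "(f has_real_derivative f' q) (at q within {t..s})"
      by (rule DERIV_subset[OF deriv[OF q] sub])
    show "- c * f q \<le> f' q"
      using le[OF q] by linarith
  qed
  then have "exp (- (c * (s - t))) * f t \<le> f s"
    by simp
  then show ?thesis
    unfolding exp_minus_mult_le_iff using \<open>t \<le> s\<close> by simp
qed

lemma has_real_derivative_inner_self:
  fixes u :: "real \<Rightarrow> 'a::real_inner"
  assumes "(u has_vector_derivative u') (at t within T)"
  shows "((\<lambda>t. u t \<bullet> u t) has_real_derivative 2 * (u t \<bullet> u')) (at t within T)"
  using has_derivative_inner[OF assms[unfolded has_vector_derivative_def]
      assms[unfolded has_vector_derivative_def]]
  unfolding has_field_derivative_def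
  by (rule has_derivative_eq_rhs) (auto simp: inner_commute algebra_simps fun_eq_iff)

lemma gronwall_norm:
  fixes u :: "real \<Rightarrow> 'a::real_inner"
  assumes deriv: "\<And>t. t \<in> {a..b} \<Longrightarrow> (u has_vector_derivative u' t) (at t within {a..b})"
    and le: "\<And>t. t \<in> {a..b} \<Longrightarrow> norm (u' t) \<le> M * norm (u t)"
    and s: "s \<in> {a..b}" and t: "t \<in> {a..b}"
  shows "norm (u t) \<le> exp (M * \<bar>t - s\<bar>) * norm (u s)"
proof -
  have "\<bar>2 * (u q \<bullet> u' q)\<bar> \<le> (2 * M) * (u q \<bullet> u q)" if "q \<in> {a..b}" for q
  proof -
    have "\<bar>u q \<bullet> u' q\<bar> \<le> norm (u q) * (M * norm (u q))"
      using Cauchy_Schwarz_ineq2[of "u q" "u' q"] mult_left_mono[OF le[OF that] norm_ge_zero[of "u q"]]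
      by linarith
    then show ?thesis
      by (simp add: dot_square_norm power2_eq_square algebra_simps)
  qed
  from gronwall_abs[OF has_real_derivative_inner_self[OF deriv] this s t]
  have "u t \<bullet> u t \<le> exp ((2 * M) * \<bar>t - s\<bar>) * (u s \<bullet> u s)"
    by blast
  then have "(norm (u t))\<^sup>2 \<le> (exp (M * \<bar>t - s\<bar>) * norm (u s))\<^sup>2"
    by (simp add: power_mult_distrib dot_square_norm exp_double[symmetric] mult.assoc)
  then show ?thesis
    by (rule power2_le_imp_le) simp
qed

text \<open>Rescaling curves by \<open>exp (c (t - a))\<close> turns \<open>P\<close> into a contraction for the sup norm.\<close>
lemma weighted_banach_fixed_point:
  fixes P :: "(real \<Rightarrow> 'a::banach) \<Rightarrow> real \<Rightarrow> 'a"
  assumes "a \<le> b"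
    and continuous: "\<And>u. continuous_on {a..b} u \<Longrightarrow> continuous_on {a..b} (P u)"
    and contraction: "\<And>u v D t. \<lbrakk>continuous_on {a..b} u; continuous_on {a..b} v;
      \<And>s. s \<in> {a..b} \<Longrightarrow> norm (u s - v s) \<le> exp (c * (s - a)) * D; t \<in> {a..b}\<rbrakk> \<Longrightarrow>
      norm (P u t - P v t) \<le> exp (c * (t - a)) * (D / 2)"
  obtains u where "continuous_on {a..b} u" and "\<forall>t\<in>{a..b}. u t = P u t"
proof -
  define up where "up z t = exp (c * (t - a)) *\<^sub>R apply_bcontfun z t" for z :: "real \<Rightarrow>\<^sub>C 'a" and t
  define down where "down u t = exp (- (c * (t - a))) *\<^sub>R u t" for u :: "real \<Rightarrow> 'a" and t
  have continuous_up: "continuous_on {a..b} (up z)" for z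
    unfolding up_def by (intro continuous_intros) simp
  have "continuous_on (cbox a b) (down (P (up z)))" for z
    unfolding down_def using continuous[OF continuous_up] by (auto intro!: continuous_intros)
  then have "\<exists>y. \<forall>t. apply_bcontfun y t = down (P (up z)) (clamp a b t)" for z
    by (rule continuous_on_cbox_bcontfunE) blast
  then obtain T where T: "\<And>z t. apply_bcontfun (T z) t = down (P (up z)) (clamp a b t)"
    by metis
  have "dist (T z) (T y) \<le> (1/2) * dist z y" for z y
  proof (rule dist_bound)
    fix t
    have clamp: "clamp a b t \<in> {a..b}"
      using clamp_in_interval[of a b t] \<open>a \<le> b\<close> by simp
    have "norm (up z s - up y s) \<le> exp (c * (s - a)) * dist z y" for s
      using dist_bounded[of z s y] by (simp add: up_def scaleR_diff_right[symmetric] dist_norm)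
    from contraction[OF continuous_up continuous_up this clamp]
    have "exp (- (c * (clamp a b t - a))) * norm (P (up z) (clamp a b t) - P (up y) (clamp a b t)) \<le>
        dist z y / 2"
      unfolding exp_minus_mult_le_iff by simp
    then show "dist (T z t) (T y t) \<le> (1/2) * dist z y"
      by (simp add: T down_def dist_norm scaleR_diff_right[symmetric])
  qed
  then obtain z where "T z = z"
    using banach_fix_type[of "1/2" T] by auto
  then have "\<forall>t\<in>{a..b}. up z t = P (up z) t"
    using T[of z] by (auto simp: up_def down_def exp_minus)
  with continuous_up show ?thesis
    by (rule that)
qed

definition picard :: "(real \<Rightarrow> 'a \<Rightarrow> 'a) \<Rightarrow> real \<Rightarrow> 'a \<Rightarrow> (real \<Rightarrow> 'a) \<Rightarrow> real \<Rightarrow> 'a::banach" where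
  "picard X a x u t = x + integral {a..t} (\<lambda>s. X s (u s))"

lemma continuous_on_along_curve:
  assumes "continuous_on (T \<times> UNIV) (\<lambda>(t, x). X t x)" and "continuous_on T u"
  shows "continuous_on T (\<lambda>t. X t (u t))"
  using continuous_on_compose2[OF assms(1) continuous_on_Pair[OF continuous_on_id assms(2)]] by auto

lemma picard_has_vector_derivative:
  assumes "continuous_on ({a..b} \<times> UNIV) (\<lambda>(t, x). X t x)" and "continuous_on {a..b} u"
    and "t \<in> {a..b}"
  shows "(picard X a x u has_vector_derivative X t (u t)) (at t within {a..b})"
  unfolding picard_def
  using integral_has_vector_derivative[OF continuous_on_along_curve[OF assms(1,2)] assms(3)]
  by (auto intro!: derivative_eq_intros)

lemma continuous_on_picard:
  assumes "continuous_on ({a..b} \<times> UNIV) (\<lambda>(t, x). X t x)" and "continuous_on {a..b} u"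
  shows "continuous_on {a..b} (picard X a x u)"
  using picard_has_vector_derivative[OF assms] has_vector_derivative_continuous
  unfolding continuous_on_eq_continuous_within by blast

lemma norm_integral_le_exp_weight:
  fixes h :: "real \<Rightarrow> 'a::banach"
  assumes "a \<le> t" and "h integrable_on {a..t}" and "0 \<le> D"
    and le: "\<And>s. s \<in> {a..t} \<Longrightarrow> norm (h s) \<le> M * (exp (2 * M * (s - a)) * D)"
  shows "norm (integral {a..t} h) \<le> exp (2 * M * (t - a)) * (D / 2)"
proof -
  let ?g = "\<lambda>s. M * (exp (2 * M * (s - a)) * D)" and ?G = "\<lambda>s. exp (2 * M * (s - a)) * D / 2"
  have integral_g: "(?g has_integral ?G t - ?G a) {a..t}"
    using \<open>a \<le> t\<close> by (intro fundamental_theorem_of_calculus)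
      (auto intro!: derivative_eq_intros simp: has_real_derivative_iff_has_vector_derivative[symmetric])
  then have "norm (integral {a..t} h) \<le> integral {a..t} ?g"
    using assms(2) le by (intro integral_norm_bound_integral) auto
  also have "\<dots> = ?G t - D / 2"
    using integral_unique[OF integral_g] by simp
  also have "\<dots> \<le> exp (2 * M * (t - a)) * (D / 2)"
    using \<open>0 \<le> D\<close> by simp
  finally show ?thesis .
qed

lemma picard_contraction:
  fixes X :: "real \<Rightarrow> 'a::banach \<Rightarrow> 'a"
  assumes continuous: "continuous_on ({a..b} \<times> UNIV) (\<lambda>(t, x). X t x)"
    and lipschitz: "\<And>t. t \<in> {a..b} \<Longrightarrow> M-lipschitz_on UNIV (X t)"
    and u: "continuous_on {a..b} u" and v: "continuous_on {a..b} v"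
    and close: "\<And>s. s \<in> {a..b} \<Longrightarrow> norm (u s - v s) \<le> exp (2 * M * (s - a)) * D"
    and t: "t \<in> {a..b}"
  shows "norm (picard X a x u t - picard X a x v t) \<le> exp (2 * M * (t - a)) * (D / 2)"
proof -
  have sub: "{a..t} \<subseteq> {a..b}"
    using t by auto
  have integrable: "(\<lambda>s. X s (w s)) integrable_on {a..t}" if "continuous_on {a..b} w" for w
    using continuous_on_subset[OF continuous_on_along_curve[OF continuous that] sub]
    by (rule integrable_continuous_real)
  have "norm (integral {a..t} (\<lambda>s. X s (u s) - X s (v s))) \<le> exp (2 * M * (t - a)) * (D / 2)"
  proof (rule norm_integral_le_exp_weight)
    show "(\<lambda>s. X s (u s) - X s (v s)) integrable_on {a..t}"
      by (intro integrable_diff integrable u v)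
    show "0 \<le> D"
      using order_trans[OF norm_ge_zero close[of a]] t by simp
    fix s assume "s \<in> {a..t}"
    then have s: "s \<in> {a..b}"
      using sub by auto
    have "norm (X s (u s) - X s (v s)) \<le> M * norm (u s - v s)"
      using lipschitz_on_normD[OF lipschitz[OF s]] by blast
    also have "\<dots> \<le> M * (exp (2 * M * (s - a)) * D)"
      using lipschitz_on_nonneg[OF lipschitz[OF s]] by (intro mult_left_mono close s)
    finally show "norm (X s (u s) - X s (v s)) \<le> M * (exp (2 * M * (s - a)) * D)" .
  qed (use t in simp)
  then show ?thesis
    using integral_diff[OF integrable[OF u] integrable[OF v]] by (simp add: picard_def)
qed

lemma picard_lindelof:
  fixes X :: "real \<Rightarrow> 'a::banach \<Rightarrow> 'a"
  assumes continuous: "continuous_on ({a..b} \<times> UNIV) (\<lambda>(t, x). X t x)"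
    and lipschitz: "\<And>t. t \<in> {a..b} \<Longrightarrow> M-lipschitz_on UNIV (X t)"
  obtains u where "u a = x"
    and "\<And>t. t \<in> {a..b} \<Longrightarrow> (u has_vector_derivative X t (u t)) (at t within {a..b})"
proof (cases "a \<le> b")
  case False
  then show ?thesis
    using that[of "\<lambda>_. x"] by auto
next
  case True
  obtain u where u: "continuous_on {a..b} u" and fixed: "\<forall>t\<in>{a..b}. u t = picard X a x u t"
    by (rule weighted_banach_fixed_point[OF True continuous_on_picard[OF continuous, where x = x]
          picard_contraction[OF continuous lipschitz, where x = x]])
  show ?thesis
  proof (rule that[of "picard X a x u"])
    show "picard X a x u a = x"
      by (simp add: picard_def)
    show "(picard X a x u has_vector_derivative X t (picard X a x u t)) (at t within {a..b})"
      if "t \<in> {a..b}" for t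
      unfolding bspec[OF fixed that, symmetric]
      by (rule picard_has_vector_derivative[OF continuous u that])
  qed
qed

section \<open>Lipschitz maps\<close>

definition lipschitzian_on :: "'a::metric_space set \<Rightarrow> ('a \<Rightarrow> 'b::metric_space) \<Rightarrow> bool" where
  "lipschitzian_on D f \<longleftrightarrow> (\<exists>L. L-lipschitz_on D f)"

named_theorems lipschitzian_intros

lemma lipschitzian_onI: "L-lipschitz_on D f \<Longrightarrow> lipschitzian_on D f"
  by (auto simp: lipschitzian_on_def)

lemma lipschitzian_onE:
  assumes "lipschitzian_on D f"
  obtains L where "L-lipschitz_on D f"
  using assms by (auto simp: lipschitzian_on_def)

lemma lipschitzian_on_subset: "lipschitzian_on D f \<Longrightarrow> E \<subseteq> D \<Longrightarrow> lipschitzian_on E f"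
  unfolding lipschitzian_on_def using lipschitz_on_subset by blast

lemma lipschitzian_on_compose:
  assumes "lipschitzian_on E g" and "lipschitzian_on D f" and "f ` D \<subseteq> E"
  shows "lipschitzian_on D (\<lambda>x. g (f x))"
  using assms(2) lipschitzian_on_subset[OF assms(1,3)] lipschitz_on_compose2
  unfolding lipschitzian_on_def by blast

lemma lipschitzian_on_const [lipschitzian_intros]: "lipschitzian_on D (\<lambda>x. c)"
  by (rule lipschitzian_onI[OF lipschitz_on_constant])

lemma lipschitzian_on_fst [lipschitzian_intros]: "lipschitzian_on D fst"
  by (rule lipschitzian_onI[of 1], rule lipschitz_onI) (simp_all add: dist_fst_le)

lemma lipschitzian_on_snd [lipschitzian_intros]: "lipschitzian_on D snd"
  by (rule lipschitzian_onI[of 1], rule lipschitz_onI) (simp_all add: dist_snd_le)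

lemma lipschitzian_on_Pair [lipschitzian_intros]:
  "lipschitzian_on D f \<Longrightarrow> lipschitzian_on D g \<Longrightarrow> lipschitzian_on D (\<lambda>x. (f x, g x))"
  unfolding lipschitzian_on_def using lipschitz_on_Pair by blast

lemma lipschitzian_on_add [lipschitzian_intros]:
  fixes f g :: "'a::metric_space \<Rightarrow> 'b::real_normed_vector"
  shows "lipschitzian_on D f \<Longrightarrow> lipschitzian_on D g \<Longrightarrow> lipschitzian_on D (\<lambda>x. f x + g x)"
  unfolding lipschitzian_on_def using lipschitz_on_add by blast

lemma lipschitzian_on_minus [lipschitzian_intros]:
  fixes f :: "'a::metric_space \<Rightarrow> 'b::real_normed_vector"
  shows "lipschitzian_on D f \<Longrightarrow> lipschitzian_on D (\<lambda>x. - f x)"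
  unfolding lipschitzian_on_def using lipschitz_on_minus by blast

lemma lipschitzian_on_diff [lipschitzian_intros]:
  fixes f g :: "'a::metric_space \<Rightarrow> 'b::real_normed_vector"
  shows "lipschitzian_on D f \<Longrightarrow> lipschitzian_on D g \<Longrightarrow> lipschitzian_on D (\<lambda>x. f x - g x)"
  unfolding lipschitzian_on_def using lipschitz_on_diff by blast

lemma lipschitzian_on_norm [lipschitzian_intros]:
  fixes f :: "'a::metric_space \<Rightarrow> 'b::real_normed_vector"
  assumes "lipschitzian_on D f"
  shows "lipschitzian_on D (\<lambda>x. norm (f x))"
proof -
  have "1-lipschitz_on UNIV (norm :: 'b \<Rightarrow> real)"
    by (rule lipschitz_onI) (auto simp: dist_norm norm_triangle_ineq3)
  from lipschitzian_on_compose[OF lipschitzian_onI[OF this] assms] show ?thesis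
    by simp
qed

lemma lipschitzian_on_infdist: "lipschitzian_on D (\<lambda>x. infdist x S)"
  by (rule lipschitzian_onI[of 1], rule lipschitz_onI) (auto simp: dist_real_def infdist_triangle_abs)

lemma (in bounded_linear) lipschitzian_on:
  "lipschitzian_on D g \<Longrightarrow> lipschitzian_on D (\<lambda>x. f (g x))"
  using lipschitz_boundE[of UNIV] by (metis lipschitzian_on_compose lipschitzian_onI subset_UNIV)

lemma lipschitzian_on_imp_bounded:
  assumes "lipschitzian_on D f" and "bounded D"
  shows "bounded (f ` D)"
proof -
  obtain L where L: "L-lipschitz_on D f"
    by (rule lipschitzian_onE[OF assms(1)])
  obtain B where B: "\<And>x y. x \<in> D \<Longrightarrow> y \<in> D \<Longrightarrow> dist x y \<le> B"
    using assms(2) unfolding bounded_two_points by blast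
  have "dist (f x) (f y) \<le> L * B" if "x \<in> D" "y \<in> D" for x y
    using lipschitz_onD[OF L that] mult_left_mono[OF B[OF that] lipschitz_on_nonneg[OF L]] by linarith
  then show ?thesis
    unfolding bounded_two_points by blast
qed

lemma (in bounded_bilinear) lipschitzian_on:
  fixes f :: "'d::metric_space \<Rightarrow> 'a"
  assumes f: "lipschitzian_on D f" and g: "lipschitzian_on D g" and "bounded D"
  shows "lipschitzian_on D (\<lambda>x. prod (f x) (g x))"
proof -
  obtain K where "K > 0" and K: "\<And>a b. norm (prod a b) \<le> norm a * norm b * K"
    using pos_bounded by blast
  obtain L M where L: "L-lipschitz_on D f" and M: "M-lipschitz_on D g"
    using f g by (auto simp: lipschitzian_on_def)
  obtain A B where A: "A > 0" "\<And>x. x \<in> D \<Longrightarrow> norm (f x) \<le> A"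
    and B: "B > 0" "\<And>x. x \<in> D \<Longrightarrow> norm (g x) \<le> B"
    using lipschitzian_on_imp_bounded[OF f \<open>bounded D\<close>] lipschitzian_on_imp_bounded[OF g \<open>bounded D\<close>]
    unfolding bounded_pos by auto
  have "(L * B * K + A * M * K)-lipschitz_on D (\<lambda>x. prod (f x) (g x))"
  proof (rule lipschitz_onI)
    fix x y assume x: "x \<in> D" and y: "y \<in> D"
    have "norm (prod (f x) (g x) - prod (f y) (g y)) =
        norm (prod (f x - f y) (g x) + prod (f y) (g x - g y))"
      by (simp add: diff_left diff_right)
    also have "\<dots> \<le> norm (f x - f y) * norm (g x) * K + norm (f y) * norm (g x - g y) * K"
      by (intro norm_triangle_le add_mono K)
    also have "\<dots> \<le> (L * dist x y) * B * K + A * (M * dist x y) * K"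
      using x y A B \<open>K > 0\<close> lipschitz_onD[OF L x y] lipschitz_onD[OF M x y]
        lipschitz_on_nonneg[OF L] lipschitz_on_nonneg[OF M]
      by (intro add_mono mult_mono) (auto simp: dist_norm)
    finally show "dist (prod (f x) (g x)) (prod (f y) (g y)) \<le> (L * B * K + A * M * K) * dist x y"
      by (simp add: dist_norm algebra_simps)
  qed (use lipschitz_on_nonneg[OF L] lipschitz_on_nonneg[OF M] A B \<open>K > 0\<close> in simp)
  then show ?thesis
    by (rule lipschitzian_onI)
qed

lemma lipschitzian_on_vec:
  fixes f :: "'a::metric_space \<Rightarrow> 'b::metric_space ^ 'n"
  assumes "\<And>i. lipschitzian_on D (\<lambda>x. f x $ i)"
  shows "lipschitzian_on D f"
proof -
  obtain L :: "'n \<Rightarrow> real" where L: "\<And>i. (L i)-lipschitz_on D (\<lambda>x. f x $ i)"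
    using assms unfolding lipschitzian_on_def by metis
  have "(\<Sum>i\<in>UNIV. L i)-lipschitz_on D f"
  proof (rule lipschitz_onI)
    fix x y assume "x \<in> D" "y \<in> D"
    have "dist (f x) (f y) \<le> (\<Sum>i\<in>UNIV. dist (f x $ i) (f y $ i))"
      unfolding dist_vec_def by (rule L2_set_le_sum) simp
    also have "\<dots> \<le> (\<Sum>i\<in>UNIV. L i * dist x y)"
      by (intro sum_mono lipschitz_onD[OF L] \<open>x \<in> D\<close> \<open>y \<in> D\<close>)
    finally show "dist (f x) (f y) \<le> (\<Sum>i\<in>UNIV. L i) * dist x y"
      by (simp add: sum_distrib_right)
  qed (intro sum_nonneg lipschitz_on_nonneg[OF L])
  then show ?thesis
    by (rule lipschitzian_onI)
qed

lemma norm_scaleR_diff_le: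
  fixes x y :: "'a::real_normed_vector"
  shows "norm (a *\<^sub>R x - b *\<^sub>R y) \<le> \<bar>a - b\<bar> * norm x + \<bar>b\<bar> * norm (x - y)"
proof -
  have "a *\<^sub>R x - b *\<^sub>R y = (a - b) *\<^sub>R x + b *\<^sub>R (x - y)"
    by (simp add: algebra_simps)
  then show ?thesis
    by (metis norm_scaleR norm_triangle_ineq)
qed

lemma lipschitzian_on_scaleR_cutoff:
  fixes f :: "'a::metric_space \<Rightarrow> 'b::real_normed_vector"
  assumes \<phi>: "lipschitzian_on D \<phi>" "\<And>x. x \<in> D \<Longrightarrow> \<bar>\<phi> x\<bar> \<le> 1"
    and f: "lipschitzian_on {x \<in> D. \<phi> x \<noteq> 0} f" "\<And>x. x \<in> D \<Longrightarrow> \<phi> x \<noteq> 0 \<Longrightarrow> norm (f x) \<le> B"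
    and "0 \<le> B"
  shows "lipschitzian_on D (\<lambda>x. \<phi> x *\<^sub>R f x)"
proof -
  obtain K M where K: "K-lipschitz_on D \<phi>" and M: "M-lipschitz_on {x \<in> D. \<phi> x \<noteq> 0} f"
    using \<phi>(1) f(1) by (auto simp: lipschitzian_on_def)
  note nonneg = lipschitz_on_nonneg[OF K] lipschitz_on_nonneg[OF M]
  have le: "norm (\<phi> x *\<^sub>R f x - \<phi> y *\<^sub>R f y) \<le> (K * B + M) * dist x y"
    if x: "x \<in> D" "\<phi> x \<noteq> 0" and y: "y \<in> D" for x y
  proof -
    have "norm (\<phi> x *\<^sub>R f x - \<phi> y *\<^sub>R f y) \<le> \<bar>\<phi> x - \<phi> y\<bar> * norm (f x) + \<bar>\<phi> y\<bar> * norm (f x - f y)"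
      by (rule norm_scaleR_diff_le)
    also have "\<dots> \<le> (K * dist x y) * B + M * dist x y"
    proof (rule add_mono)
      show "\<bar>\<phi> x - \<phi> y\<bar> * norm (f x) \<le> (K * dist x y) * B"
        using lipschitz_onD[OF K x(1) y] f(2)[OF x] nonneg by (intro mult_mono) (auto simp: dist_norm)
      show "\<bar>\<phi> y\<bar> * norm (f x - f y) \<le> M * dist x y"
      proof (cases "\<phi> y = 0")
        case False
        then have "norm (f x - f y) \<le> M * dist x y"
          using lipschitz_onD[OF M, of x y] x y by (simp add: dist_norm)
        then show ?thesis
          using mult_mono[OF \<phi>(2)[OF y]] nonneg by fastforce
      qed (use nonneg in simp)
    qed
    finally show ?thesis
      by (simp add: algebra_simps)
  qed
  have "(K * B + M)-lipschitz_on D (\<lambda>x. \<phi> x *\<^sub>R f x)"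
  proof (rule lipschitz_onI)
    fix x y assume "x \<in> D" "y \<in> D"
    then show "dist (\<phi> x *\<^sub>R f x) (\<phi> y *\<^sub>R f y) \<le> (K * B + M) * dist x y"
      using le[of x y] le[of y x, unfolded dist_commute[of y] norm_minus_commute[of "\<phi> y *\<^sub>R f y"]]
        nonneg \<open>0 \<le> B\<close>
      unfolding dist_norm[of "\<phi> x *\<^sub>R f x"] by (cases "\<phi> x = 0"; cases "\<phi> y = 0") simp_all
  qed (use nonneg \<open>0 \<le> B\<close> in simp)
  then show ?thesis
    by (rule lipschitzian_onI)
qed

section \<open>Time-one maps of vector fields vanishing on a closed set\<close>

definition integral_curve :: "(real \<Rightarrow> 'a \<Rightarrow> 'a) \<Rightarrow> 'a set \<Rightarrow> (real \<Rightarrow> 'a::real_normed_vector) \<Rightarrow> bool" where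
  "integral_curve X B u \<longleftrightarrow>
     (\<forall>t\<in>{0..1}. u t \<in> B \<and> (u has_vector_derivative X t (u t)) (at t within {0..1}))"

lemma integral_curveD:
  assumes "integral_curve X B u" and "t \<in> {0..1}"
  shows "u t \<in> B" and "(u has_vector_derivative X t (u t)) (at t within {0..1})"
  using assms by (auto simp: integral_curve_def)

definition reverse_field :: "(real \<Rightarrow> 'a \<Rightarrow> 'a) \<Rightarrow> real \<Rightarrow> 'a \<Rightarrow> 'a::real_normed_vector" where
  "reverse_field X t x = - X (1 - t) x"

lemma reverse_field_reverse_field [simp]: "reverse_field (reverse_field X) = X"
  by (simp add: reverse_field_def fun_eq_iff)

lemma integral_curve_reverse_field:
  assumes "integral_curve X B u"
  shows "integral_curve (reverse_field X) B (\<lambda>t. u (1 - t))"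
  unfolding integral_curve_def
proof (intro ballI conjI)
  fix t :: real assume "t \<in> {0..1}"
  then have t': "1 - t \<in> {0..1}"
    by auto
  then show "u (1 - t) \<in> B"
    by (rule integral_curveD(1)[OF assms])
  have "(u has_vector_derivative X (1 - t) (u (1 - t))) (at (1 - t) within (\<lambda>t. 1 - t) ` {0..1})"
    using integral_curveD(2)[OF assms t'] by (simp add: image_diff_atLeastAtMost)
  moreover have "((\<lambda>t. 1 - t) has_vector_derivative - 1) (at t within {0..1})"
    by (auto intro!: derivative_eq_intros)
  ultimately show "((\<lambda>t. u (1 - t)) has_vector_derivative reverse_field X t (u (1 - t)))
      (at t within {0..1})"
    using vector_diff_chain_within[of "\<lambda>t. 1 - t" "- 1" t "{0..1}" u]
    by (simp add: o_def reverse_field_def)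
qed

definition time_one_map :: "(real \<Rightarrow> 'a \<Rightarrow> 'a) \<Rightarrow> 'a set \<Rightarrow> 'a \<Rightarrow> 'a::real_normed_vector" where
  "time_one_map X B x = (SOME u. integral_curve X B u \<and> u 0 = x) 1"

lemma infdist_le_norm: "y \<in> S \<Longrightarrow> infdist x S \<le> norm (x - y)"
  by (metis dist_norm infdist_le)

text \<open>Since \<open>infdist x S\<close> need not be differentiable, Gronwall's inequality is applied to \<open>u - y\<close> for
  each single \<open>y \<in> S\<close>.\<close>
lemma norm_diff_le_exp_growth:
  fixes u :: "real \<Rightarrow> 'a::real_inner"
  assumes deriv: "\<And>t. t \<in> {0..1} \<Longrightarrow> (u has_vector_derivative u' t) (at t within {0..1})"
    and growth: "\<And>t. t \<in> {0..1} \<Longrightarrow> norm (u' t) \<le> L * infdist (u t) S" and "0 \<le> L"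
    and "y \<in> S" and s: "s \<in> {0..1}" and t: "t \<in> {0..1}"
  shows "norm (u t - y) \<le> exp L * norm (u s - y)"
proof -
  have "norm (u t - y) \<le> exp (L * \<bar>t - s\<bar>) * norm (u s - y)"
  proof (rule gronwall_norm[OF _ _ s t])
    fix q :: real assume q: "q \<in> {0..1}"
    show "((\<lambda>q. u q - y) has_vector_derivative u' q) (at q within {0..1})"
      using deriv[OF q] by (auto intro!: derivative_eq_intros)
    show "norm (u' q) \<le> L * norm (u q - y)"
      using growth[OF q] mult_left_mono[OF infdist_le_norm[OF \<open>y \<in> S\<close>] \<open>0 \<le> L\<close>] order_trans by blast
  qed
  also have "\<dots> \<le> exp L * norm (u s - y)"
    using \<open>0 \<le> L\<close> s t by (intro mult_right_mono) (auto simp: abs_le_iff mult_left_le)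
  finally show ?thesis .
qed

lemma infdist_le_exp_growth:
  fixes u :: "real \<Rightarrow> 'a::real_inner"
  assumes "\<And>t. t \<in> {0..1} \<Longrightarrow> (u has_vector_derivative u' t) (at t within {0..1})"
    and "\<And>t. t \<in> {0..1} \<Longrightarrow> norm (u' t) \<le> L * infdist (u t) S" and "0 \<le> L"
    and "S \<noteq> {}" and "s \<in> {0..1}" and "t \<in> {0..1}"
  shows "infdist (u t) S \<le> exp L * infdist (u s) S"
proof -
  have "exp (- L) * infdist (u t) S \<le> dist (u s) y" if "y \<in> S" for y
    using norm_diff_le_exp_growth[OF assms(1-3) that assms(5,6)] infdist_le_norm[OF that, of "u t"]
    unfolding exp_minus_mult_le_iff dist_norm by linarith
  then have "exp (- L) * infdist (u t) S \<le> infdist (u s) S"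
    unfolding infdist_notempty[OF \<open>S \<noteq> {}\<close>, of "u s"] using \<open>S \<noteq> {}\<close> by (intro cINF_greatest)
  then show ?thesis
    unfolding exp_minus_mult_le_iff .
qed

text \<open>The Lipschitz constants may blow up at \<open>S\<close>; the growth bound keeps integral curves off \<open>S\<close>.\<close>
locale vanishing_field =
  fixes S :: "'a::euclidean_space set" and X :: "real \<Rightarrow> 'a \<Rightarrow> 'a" and \<rho> L :: real
  assumes closed: "closed S" and zero: "0 \<in> S" and \<rho>: "0 < \<rho>" and L: "0 \<le> L"
    and growth: "\<And>t x. \<lbrakk>t \<in> {0..1}; x \<in> cball 0 \<rho>\<rbrakk> \<Longrightarrow> norm (X t x) \<le> L * infdist x S"
    and lipschitzian: "\<And>\<epsilon>. \<epsilon> > 0 \<Longrightarrow>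
      lipschitzian_on ({0..1} \<times> {x \<in> cball 0 \<rho>. \<epsilon> \<le> infdist x S}) (\<lambda>p. X (fst p) (snd p))"
begin

lemma vanishing_field_reverse: "vanishing_field S (reverse_field X) \<rho> L"
proof
  show "norm (reverse_field X t x) \<le> L * infdist x S" if "t \<in> {0..1}" "x \<in> cball 0 \<rho>" for t x
    using growth[of "1 - t" x] that by (auto simp: reverse_field_def)
  fix \<epsilon> :: real assume "\<epsilon> > 0"
  let ?E = "{0..1::real} \<times> {x \<in> cball 0 \<rho>. \<epsilon> \<le> infdist x S}"
  have "lipschitzian_on ?E (\<lambda>p. (1 - fst p, snd p))"
    by (intro lipschitzian_intros)
  moreover have "(\<lambda>p. (1 - fst p, snd p)) ` ?E \<subseteq> ?E"
    by auto
  ultimately have "lipschitzian_on ?E (\<lambda>p. X (1 - fst p) (snd p))"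
    using lipschitzian_on_compose[OF lipschitzian[OF \<open>\<epsilon> > 0\<close>]] by fastforce
  from lipschitzian_on_minus[OF this] show "lipschitzian_on ?E (\<lambda>p. reverse_field X (fst p) (snd p))"
    by (simp add: reverse_field_def)
qed (fact closed zero \<rho> L)+

lemma infdist_pos: "x \<notin> S \<Longrightarrow> 0 < infdist x S"
  using infdist_pos_not_in_closed[OF closed] zero by blast

lemma growth_norm: "t \<in> {0..1} \<Longrightarrow> x \<in> cball 0 \<rho> \<Longrightarrow> norm (X t x) \<le> L * norm x"
  using growth[of t x] mult_left_mono[OF infdist_le_norm[OF zero, of x] L] by simp

definition cutoff :: "real \<Rightarrow> 'a \<Rightarrow> real" where
  "cutoff \<epsilon> x = max 0 (min 1 (2 * infdist x S / \<epsilon> - 1))"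

definition truncation :: "real \<Rightarrow> real \<Rightarrow> 'a \<Rightarrow> 'a" where
  "truncation \<epsilon> t x = cutoff \<epsilon> (closest_point (cball 0 \<rho>) x) *\<^sub>R X t (closest_point (cball 0 \<rho>) x)"

lemma cutoff_nonneg: "0 \<le> cutoff \<epsilon> x" and cutoff_le_1: "cutoff \<epsilon> x \<le> 1"
  by (auto simp: cutoff_def)

lemma lipschitzian_on_cutoff_field:
  assumes "\<epsilon> > 0"
  shows "lipschitzian_on ({0..1} \<times> cball 0 \<rho>) (\<lambda>p. cutoff \<epsilon> (snd p) *\<^sub>R X (fst p) (snd p))"
proof (rule lipschitzian_on_scaleR_cutoff[where B = "L * \<rho>"])
  have "1-lipschitz_on UNIV (\<lambda>c::real. max 0 (min 1 c))"
    by (rule lipschitz_onI) (auto simp: dist_real_def)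
  moreover have "lipschitzian_on UNIV (\<lambda>x. (2 / \<epsilon>) *\<^sub>R infdist x S - 1)"
    by (intro lipschitzian_intros bounded_linear.lipschitzian_on[OF bounded_linear_scaleR_right]
        lipschitzian_on_infdist)
  ultimately have "lipschitzian_on UNIV (cutoff \<epsilon>)"
    using lipschitzian_on_compose[OF lipschitzian_onI] unfolding cutoff_def by fastforce
  then show "lipschitzian_on ({0..1::real} \<times> cball 0 \<rho>) (\<lambda>p. cutoff \<epsilon> (snd p))"
    by (rule lipschitzian_on_compose[OF _ lipschitzian_on_snd]) simp
  have "\<epsilon> / 2 \<le> infdist x S" if "cutoff \<epsilon> x \<noteq> 0" for x
    using that \<open>\<epsilon> > 0\<close> by (auto simp: cutoff_def field_simps max_def min_def split: if_splits)
  then show "lipschitzian_on {p \<in> {0..1} \<times> cball 0 \<rho>. cutoff \<epsilon> (snd p) \<noteq> 0} (\<lambda>p. X (fst p) (snd p))"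
    using \<open>\<epsilon> > 0\<close> by (intro lipschitzian_on_subset[OF lipschitzian[of "\<epsilon> / 2"]]) auto
  show "norm (X (fst p) (snd p)) \<le> L * \<rho>" if "p \<in> {0..1} \<times> cball 0 \<rho>" for p
    using that growth_norm[of "fst p" "snd p"] mult_left_mono[OF _ L, of "norm (snd p)" \<rho>]
    by auto
qed (use cutoff_nonneg cutoff_le_1 L \<rho> in auto)

lemma closest_point_cball: "closest_point (cball 0 \<rho>) x \<in> cball 0 \<rho>" for x :: 'a
  using \<rho> by (intro closest_point_in_set) auto

lemma norm_closest_point_cball_le: "norm (closest_point (cball 0 \<rho>) x) \<le> norm x" for x :: 'a
proof -
  have "closest_point (cball 0 \<rho>) 0 = (0::'a)"
    using \<rho> by (simp add: closest_point_self)
  then show ?thesis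
    using closest_point_lipschitz[of "cball 0 \<rho>" x 0] \<rho> by (simp add: dist_norm)
qed

lemma lipschitzian_on_truncation:
  assumes "\<epsilon> > 0"
  shows "lipschitzian_on ({0..1} \<times> UNIV) (\<lambda>p. truncation \<epsilon> (fst p) (snd p))"
proof -
  let ?\<pi> = "\<lambda>p :: real \<times> 'a. (fst p, closest_point (cball 0 \<rho>) (snd p))"
  have "1-lipschitz_on UNIV (closest_point (cball (0::'a) \<rho>))"
    using \<rho> by (intro lipschitz_onI) (auto intro!: closest_point_lipschitz)
  note lipschitzian_on_compose[OF lipschitzian_onI[OF this] lipschitzian_on_snd subset_UNIV]
  then have "lipschitzian_on ({0..1} \<times> UNIV) ?\<pi>"
    by (intro lipschitzian_intros)
  moreover have "?\<pi> ` ({0..1} \<times> UNIV) \<subseteq> {0..1} \<times> cball 0 \<rho>"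
    using closest_point_cball by auto
  ultimately show ?thesis
    using lipschitzian_on_compose[OF lipschitzian_on_cutoff_field[OF assms], of _ ?\<pi>]
    by (simp add: truncation_def)
qed

lemma norm_truncation_le:
  assumes "t \<in> {0..1}"
  shows "norm (truncation \<epsilon> t x) \<le> norm (X t (closest_point (cball 0 \<rho>) x))"
  unfolding truncation_def using cutoff_nonneg cutoff_le_1 by (simp add: mult_left_le_one_le)

lemma truncation_eq:
  assumes "x \<in> cball 0 \<rho>" and "\<epsilon> \<le> infdist x S" and "\<epsilon> > 0"
  shows "truncation \<epsilon> t x = X t x"
proof -
  have "cutoff \<epsilon> x = 1"
    using assms(2,3) by (simp add: cutoff_def field_simps)
  then show ?thesis
    using closest_point_self[OF assms(1)] by (simp add: truncation_def)
qed

lemma truncation_curve_exists: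
  assumes "\<epsilon> > 0"
  obtains u where "u 0 = x"
    and "\<And>t. t \<in> {0..1} \<Longrightarrow> (u has_vector_derivative truncation \<epsilon> t (u t)) (at t within {0..1})"
proof -
  obtain M where M: "M-lipschitz_on ({0..1} \<times> UNIV) (\<lambda>p. truncation \<epsilon> (fst p) (snd p))"
    by (rule lipschitzian_onE[OF lipschitzian_on_truncation[OF assms]])
  have "M-lipschitz_on UNIV (truncation \<epsilon> t)" if "t \<in> {0..1}" for t
    using lipschitz_onD[OF M, of "(t, _)" "(t, _)"] lipschitz_on_nonneg[OF M] that
    by (auto intro!: lipschitz_onI simp: dist_Pair_Pair)
  moreover have "continuous_on ({0..1} \<times> UNIV) (\<lambda>(t, x). truncation \<epsilon> t x)"
    using lipschitz_on_continuous_on[OF M] by (simp add: case_prod_unfold)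
  ultimately show ?thesis
    using picard_lindelof[of 0 1 "truncation \<epsilon>" M x] that by blast
qed

lemma truncation_curve_in_cball:
  assumes deriv: "\<And>t. t \<in> {0..1} \<Longrightarrow> (u has_vector_derivative truncation \<epsilon> t (u t)) (at t within {0..1})"
    and start: "norm (u 0) \<le> exp (- L) * \<rho>" and t: "t \<in> {0..1}"
  shows "u t \<in> cball 0 \<rho>"
proof -
  have "norm (truncation \<epsilon> t (u t)) \<le> L * infdist (u t) {0}" if t: "t \<in> {0..1}" for t
    using order_trans[OF norm_truncation_le[OF t] growth_norm[OF t closest_point_cball]]
      mult_left_mono[OF norm_closest_point_cball_le L] order_trans by fastforce
  from norm_diff_le_exp_growth[OF deriv this L, of 0 0 t]
  have "norm (u t) \<le> exp L * norm (u 0)"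
    using t by simp
  also have "\<dots> \<le> exp L * (exp (- L) * \<rho>)"
    by (intro mult_left_mono start) simp
  finally show ?thesis
    by (simp add: exp_minus_inverse mult.assoc[symmetric])
qed

lemma integral_curve_exists:
  assumes x: "norm x \<le> exp (- L) * \<rho>"
  obtains u where "integral_curve X (cball 0 \<rho>) u" and "u 0 = x"
proof (cases "x \<in> S")
  case True
  have "exp (- L) * \<rho> \<le> \<rho>"
    using L \<rho> by simp
  then have "x \<in> cball 0 \<rho>"
    using x by simp
  then show ?thesis
    using that[of "\<lambda>_. x"] growth[of _ x] True by (auto simp: integral_curve_def)
next
  case False
  define \<epsilon> where "\<epsilon> = exp (- L) * infdist x S"
  have "\<epsilon> > 0"
    using infdist_pos[OF False] by (simp add: \<epsilon>_def)
  obtain u where "u 0 = x" and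
    deriv: "\<And>t. t \<in> {0..1} \<Longrightarrow> (u has_vector_derivative truncation \<epsilon> t (u t)) (at t within {0..1})"
    using truncation_curve_exists[OF \<open>\<epsilon> > 0\<close>] by blast
  have in_ball: "u t \<in> cball 0 \<rho>" if "t \<in> {0..1}" for t
    by (rule truncation_curve_in_cball[OF deriv _ that]) (use x \<open>u 0 = x\<close> in simp_all)
  have off: "\<epsilon> \<le> infdist (u t) S" if "t \<in> {0..1}" for t
  proof -
    have "norm (truncation \<epsilon> t (u t)) \<le> L * infdist (u t) S" if t: "t \<in> {0..1}" for t
      using order_trans[OF norm_truncation_le[OF t] growth[OF t closest_point_cball], of \<epsilon> "u t"]
      by (simp add: closest_point_self[OF in_ball[OF t]])
    from infdist_le_exp_growth[OF deriv this L, of t 0] show ?thesis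
      using that zero \<open>u 0 = x\<close> unfolding \<epsilon>_def exp_minus_mult_le_iff by auto
  qed
  have "integral_curve X (cball 0 \<rho>) u"
    using deriv in_ball truncation_eq[OF in_ball off \<open>\<epsilon> > 0\<close>] by (auto simp: integral_curve_def)
  then show ?thesis
    using \<open>u 0 = x\<close> by (rule that)
qed

context
  fixes u :: "real \<Rightarrow> 'a" and s t :: real
  assumes u: "integral_curve X (cball 0 \<rho>) u" and s: "s \<in> {0..1}" and t: "t \<in> {0..1}"
begin

lemma norm_integral_curve_diff_le: "y \<in> S \<Longrightarrow> norm (u t - y) \<le> exp L * norm (u s - y)"
  using norm_diff_le_exp_growth[OF integral_curveD(2)[OF u] growth L _ s t] integral_curveD(1)[OF u]
  by blast

lemma infdist_integral_curve_le: "infdist (u t) S \<le> exp L * infdist (u s) S"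
  using infdist_le_exp_growth[OF integral_curveD(2)[OF u] growth L _ s t] integral_curveD(1)[OF u] zero
  by blast

lemma integral_curve_const: "u s \<in> S \<Longrightarrow> u t = u s"
  using norm_integral_curve_diff_le[of "u s"] by simp

end

lemma integral_curves_lipschitz:
  assumes "\<epsilon> > 0"
  obtains M where "\<And>u v. \<lbrakk>integral_curve X (cball 0 \<rho>) u; integral_curve X (cball 0 \<rho>) v;
    \<epsilon> \<le> infdist (u 0) S; \<epsilon> \<le> infdist (v 0) S\<rbrakk> \<Longrightarrow> norm (u 1 - v 1) \<le> exp M * norm (u 0 - v 0)"
proof -
  let ?E = "{x \<in> cball 0 \<rho>. exp (- L) * \<epsilon> \<le> infdist x S}"
  obtain M where M: "M-lipschitz_on ({0..1} \<times> ?E) (\<lambda>p. X (fst p) (snd p))"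
    using lipschitzian[of "exp (- L) * \<epsilon>"] assms by (auto elim: lipschitzian_onE)
  have in_E: "u t \<in> ?E"
    if "integral_curve X (cball 0 \<rho>) u" "\<epsilon> \<le> infdist (u 0) S" "t \<in> {0..1}" for u t
    using infdist_integral_curve_le[OF that(1,3), of 0] integral_curveD(1)[OF that(1,3)] that(2)
    unfolding exp_minus_mult_le_iff by auto
  have "norm (u 1 - v 1) \<le> exp M * norm (u 0 - v 0)"
    if u: "integral_curve X (cball 0 \<rho>) u" "\<epsilon> \<le> infdist (u 0) S"
      and v: "integral_curve X (cball 0 \<rho>) v" "\<epsilon> \<le> infdist (v 0) S" for u v
  proof -
    have "((\<lambda>t. u t - v t) has_vector_derivative X t (u t) - X t (v t)) (at t within {0..1})"
      if "t \<in> {0..1}" for t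
      by (intro has_vector_derivative_diff integral_curveD(2)[OF u(1) that] integral_curveD(2)[OF v(1) that])
    moreover have "norm (X t (u t) - X t (v t)) \<le> M * norm (u t - v t)" if t: "t \<in> {0..1}" for t
      using lipschitz_onD[OF M, of "(t, u t)" "(t, v t)"] in_E[OF u t] in_E[OF v t] t
      by (simp add: dist_Pair_Pair dist_norm)
    ultimately show ?thesis
      using gronwall_norm[where u = "\<lambda>t. u t - v t" and s = 0 and t = 1] by force
  qed
  then show ?thesis
    by (rule that)
qed

lemma integral_curve_unique:
  assumes u: "integral_curve X (cball 0 \<rho>) u" and v: "integral_curve X (cball 0 \<rho>) v" and "u 0 = v 0"
  shows "u 1 = v 1"
proof (cases "u 0 \<in> S")
  case True
  then show ?thesis
    using integral_curve_const[OF u, of 0 1] integral_curve_const[OF v, of 0 1] \<open>u 0 = v 0\<close> by simp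
next
  case False
  obtain M where "norm (u 1 - v 1) \<le> exp M * norm (u 0 - v 0)"
    using integral_curves_lipschitz[OF infdist_pos[OF False]] u v \<open>u 0 = v 0\<close> by (metis order_refl)
  then show ?thesis
    using \<open>u 0 = v 0\<close> by simp
qed

abbreviation \<phi> :: "'a \<Rightarrow> 'a" where
  "\<phi> \<equiv> time_one_map X (cball 0 \<rho>)"

lemma time_one_map_eq:
  assumes "integral_curve X (cball 0 \<rho>) u"
  shows "\<phi> (u 0) = u 1"
  unfolding time_one_map_def
  by (rule someI2[of _ u]) (use assms integral_curve_unique in auto)

lemma time_one_map_curve:
  assumes "norm x \<le> exp (- L) * \<rho>"
  obtains u where "integral_curve X (cball 0 \<rho>) u" "u 0 = x" "u 1 = \<phi> x"
  using integral_curve_exists[OF assms] time_one_map_eq by metis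

lemma norm_time_one_map_diff_le:
  assumes "norm x \<le> exp (- L) * \<rho>" and "y \<in> S"
  shows "norm (\<phi> x - y) \<le> exp L * norm (x - y)"
  using time_one_map_curve[OF assms(1)] norm_integral_curve_diff_le[of _ 0 1 y] assms(2)
  by (metis atLeastAtMost_iff order_refl zero_le_one)

lemma norm_time_one_map_less:
  assumes "norm x < exp (- L) * R" and "norm x \<le> exp (- L) * \<rho>"
  shows "norm (\<phi> x) < R"
proof -
  have "norm (\<phi> x) \<le> exp L * norm x"
    using norm_time_one_map_diff_le[OF assms(2) zero] by simp
  also have "\<dots> < exp L * (exp (- L) * R)"
    using assms(1) by simp
  finally show ?thesis
    by (simp add: exp_minus_inverse mult.assoc[symmetric])
qed

lemma time_one_map_fixes: "x \<in> S \<Longrightarrow> norm x \<le> exp (- L) * \<rho> \<Longrightarrow> \<phi> x = x"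
  using norm_time_one_map_diff_le[of x x] by simp

lemma time_one_map_inverse:
  assumes "norm x \<le> exp (- L) * \<rho>"
  shows "time_one_map (reverse_field X) (cball 0 \<rho>) (\<phi> x) = x"
proof -
  obtain u where u: "integral_curve X (cball 0 \<rho>) u" "u 0 = x" "u 1 = \<phi> x"
    by (rule time_one_map_curve[OF assms])
  interpret reverse: vanishing_field S "reverse_field X" \<rho> L
    by (rule vanishing_field_reverse)
  show ?thesis
    using reverse.time_one_map_eq[OF integral_curve_reverse_field[OF u(1)]] u(2,3) by simp
qed

lemma lipschitzian_on_time_one_map:
  assumes "\<epsilon> > 0"
  shows "lipschitzian_on {x \<in> cball 0 (exp (- L) * \<rho>). \<epsilon> \<le> infdist x S} \<phi>"
proof -
  obtain M where M: "\<And>u v. \<lbrakk>integral_curve X (cball 0 \<rho>) u; integral_curve X (cball 0 \<rho>) v;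
    \<epsilon> \<le> infdist (u 0) S; \<epsilon> \<le> infdist (v 0) S\<rbrakk> \<Longrightarrow> norm (u 1 - v 1) \<le> exp M * norm (u 0 - v 0)"
    using integral_curves_lipschitz[OF assms] by blast
  have "(exp M)-lipschitz_on {x \<in> cball 0 (exp (- L) * \<rho>). \<epsilon> \<le> infdist x S} \<phi>"
  proof (rule lipschitz_onI)
    fix x y
    assume x: "x \<in> {x \<in> cball 0 (exp (- L) * \<rho>). \<epsilon> \<le> infdist x S}"
      and y: "y \<in> {x \<in> cball 0 (exp (- L) * \<rho>). \<epsilon> \<le> infdist x S}"
    obtain u where u: "integral_curve X (cball 0 \<rho>) u" "u 0 = x" "u 1 = \<phi> x"
      using x by (auto intro: time_one_map_curve)
    obtain v where v: "integral_curve X (cball 0 \<rho>) v" "v 0 = y" "v 1 = \<phi> y"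
      using y by (auto intro: time_one_map_curve)
    show "dist (\<phi> x) (\<phi> y) \<le> exp M * dist x y"
      using M[OF u(1) v(1)] u v x y by (simp add: dist_norm)
  qed simp
  then show ?thesis
    by (rule lipschitzian_onI)
qed

lemma continuous_on_time_one_map: "continuous_on (cball 0 (exp (- L) * \<rho>)) \<phi>"
  unfolding continuous_on_eq_continuous_within
proof
  let ?B = "cball (0::'a) (exp (- L) * \<rho>)"
  fix x assume x: "x \<in> ?B"
  show "continuous (at x within ?B) \<phi>"
  proof (cases "x \<in> S")
    case True
    have "((\<lambda>y. exp L * norm (y - x)) \<longlongrightarrow> 0) (at x within ?B)"
      by (auto intro!: tendsto_eq_intros)
    moreover have "\<forall>\<^sub>F y in at x within ?B. norm (\<phi> y - x) \<le> exp L * norm (y - x)"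
      unfolding eventually_at_filter using True
      by (intro always_eventually) (simp add: norm_time_one_map_diff_le)
    ultimately have "((\<lambda>y. \<phi> y - x) \<longlongrightarrow> 0) (at x within ?B)"
      by (rule Lim_null_comparison[rotated])
    then show ?thesis
      using time_one_map_fixes[OF True] x by (simp add: continuous_within LIM_zero_iff)
  next
    case False
    define \<epsilon> where "\<epsilon> = infdist x S / 2"
    have \<epsilon>: "0 < \<epsilon>" "\<epsilon> < infdist x S"
      using infdist_pos[OF False] by (auto simp: \<epsilon>_def)
    have "continuous_on {y \<in> ?B. \<epsilon> \<le> infdist y S} \<phi>"
      using lipschitzian_on_time_one_map[OF \<epsilon>(1)]
      by (auto elim: lipschitzian_onE intro: lipschitz_on_continuous_on)
    then have "continuous_on (?B \<inter> {y. \<epsilon> < infdist y S}) \<phi>"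
      by (rule continuous_on_subset) auto
    then have "continuous (at x within ?B \<inter> {y. \<epsilon> < infdist y S}) \<phi>"
      using x \<epsilon> by (simp add: continuous_on_eq_continuous_within)
    moreover have "open {y. \<epsilon> < infdist y S}"
      by (intro open_Collect_less continuous_intros)
    ultimately show ?thesis
      using at_within_nhd[of x "{y. \<epsilon> < infdist y S}" "?B \<inter> {y. \<epsilon> < infdist y S}" ?B] \<epsilon>(2) by simp
  qed
qed

lemma time_one_map_homeomorphism:
  obtains U V where "open U" "0 \<in> U" "open V" "0 \<in> V" "U \<subseteq> cball 0 (exp (- L) * \<rho>)"
    and "homeomorphism U V \<phi> (time_one_map (reverse_field X) (cball 0 \<rho>))"
proof -
  interpret reverse: vanishing_field S "reverse_field X" \<rho> L
    by (rule vanishing_field_reverse)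
  define R where "R = exp (- L) * \<rho>"
  have "R > 0" "exp (- L) * R \<le> R"
    using \<rho> L by (auto simp: R_def)
  define U V where "U = ball 0 (exp (- L) * R)" and "V = ball 0 R \<inter> reverse.\<phi> -` U"
  have U: "norm x \<le> R" if "x \<in> U" for x
    using that \<open>exp (- L) * R \<le> R\<close> by (simp add: U_def)
  have \<phi>_U: "\<phi> x \<in> V \<and> reverse.\<phi> (\<phi> x) = x" if "x \<in> U" for x
    using time_one_map_inverse[of x] norm_time_one_map_less[of x R] U[OF that] that
    by (simp add: U_def V_def R_def)
  have reverse_V: "reverse.\<phi> y \<in> U \<and> \<phi> (reverse.\<phi> y) = y" if "y \<in> V" for y
    using reverse.time_one_map_inverse[of y] that by (simp add: V_def R_def)
  have "open V"
    unfolding V_def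
    by (rule continuous_open_preimage[OF continuous_on_subset[OF reverse.continuous_on_time_one_map]])
      (auto simp: U_def R_def)
  moreover have "0 \<in> V"
    using reverse.time_one_map_fixes[OF zero] \<rho> \<open>R > 0\<close> by (simp add: V_def U_def)
  moreover have "homeomorphism U V \<phi> reverse.\<phi>"
  proof (rule homeomorphismI)
    show "continuous_on U \<phi>"
      using U by (intro continuous_on_subset[OF continuous_on_time_one_map]) (auto simp: R_def)
    show "continuous_on V reverse.\<phi>"
      by (rule continuous_on_subset[OF reverse.continuous_on_time_one_map]) (auto simp: V_def R_def)
  qed (use \<phi>_U reverse_V in auto)
  moreover have "open U" "0 \<in> U" "U \<subseteq> cball 0 (exp (- L) * \<rho>)"
    using U \<open>R > 0\<close> by (auto simp: U_def R_def)
  ultimately show ?thesis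
    using that by blast
qed

lemma sigma_V_equiv_if_curves_carry_zeros:
  assumes zeros: "\<And>u. integral_curve X (cball 0 \<rho>) u \<Longrightarrow> f (u 0) = 0 \<longleftrightarrow> g (u 1) = 0"
  shows "sigma_V_equiv S f g"
proof -
  let ?\<psi> = "time_one_map (reverse_field X) (cball 0 \<rho>)"
  obtain U V where UV: "open U" "0 \<in> U" "open V" "0 \<in> V" "U \<subseteq> cball 0 (exp (- L) * \<rho>)"
    and homeo: "homeomorphism U V \<phi> ?\<psi>"
    by (rule time_one_map_homeomorphism)
  have "f x = 0 \<longleftrightarrow> g (\<phi> x) = 0" if "x \<in> U" for x
    using time_one_map_curve[of x] zeros that UV(5) by (metis mem_cball_0 subsetD)
  then have "\<phi> ` (f -` {0} \<inter> U) = g -` {0} \<inter> V"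
    using homeomorphism_image1[OF homeo] by auto
  then have "homeomorphism (f -` {0} \<inter> U) (g -` {0} \<inter> V) \<phi> ?\<psi>"
    by (intro homeomorphism_of_subsets[OF homeo]) auto
  moreover have "\<forall>x \<in> f -` {0} \<inter> S \<inter> U. \<phi> x = x"
    using time_one_map_fixes UV(5) by auto
  ultimately show ?thesis
    unfolding sigma_V_equiv_def using UV(1-4) by blast
qed

end

section \<open>The regularised normal equation\<close>

lemma norm_matrix_vector_mult_le:
  fixes A :: "real^'n^'m"
  shows "norm (A *v x) \<le> norm A * norm x"
proof -
  have "norm (A *v x) = L2_set (\<lambda>i. norm ((A *v x) $ i)) UNIV"
    by (simp add: norm_vec_def)
  also have "\<dots> \<le> L2_set (\<lambda>i. norm (A $ i) * norm x) UNIV"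
    by (intro L2_set_mono) (auto simp: matrix_mult_dot Cauchy_Schwarz_ineq2)
  also have "\<dots> = norm A * norm x"
    by (simp add: norm_vec_def L2_set_left_distrib)
  finally show ?thesis .
qed

lemma norm_vector_matrix_mult_le:
  fixes A :: "real^'n^'m"
  shows "norm (x v* A) \<le> norm A * norm x"
proof -
  have "(norm (x v* A))\<^sup>2 = x \<bullet> (A *v (x v* A))"
    by (metis dot_lmul_matrix power2_norm_eq_inner)
  also have "\<dots> \<le> norm x * (norm A * norm (x v* A))"
    by (meson norm_cauchy_schwarz norm_matrix_vector_mult_le mult_left_mono norm_ge_zero order_trans)
  finally have "norm (x v* A) * norm (x v* A) \<le> (norm A * norm x) * norm (x v* A)"
    by (simp add: power2_eq_square algebra_simps)
  then show ?thesis
    by (cases "norm (x v* A) = 0") (auto simp: mult_le_cancel_right)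
qed

lemma bounded_bilinear_matrix_vector_mult:
  "bounded_bilinear ((*v) :: real^'n^'m \<Rightarrow> real^'n \<Rightarrow> real^'m)"
  unfolding bilinear_conv_bounded_bilinear[symmetric] bilinear_def
  by (auto intro!: linearI simp: matrix_vector_mult_add_rdistrib scaleR_matrix_vector_assoc
      matrix_vector_right_distrib)

lemma bounded_bilinear_vector_matrix_mult:
  "bounded_bilinear ((v*) :: real^'m \<Rightarrow> real^'n^'m \<Rightarrow> real^'n)"
  unfolding bilinear_conv_bounded_bilinear[symmetric] bilinear_def
  by (auto intro!: linearI
      simp: vec_eq_iff vector_matrix_mult_def sum.distrib sum_distrib_left algebra_simps)

lemma bounded_bilinear_matrix_matrix_mult:
  "bounded_bilinear ((**) :: real^'n^'m \<Rightarrow> real^'p^'n \<Rightarrow> real^'p^'m)"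
  unfolding bilinear_conv_bounded_bilinear[symmetric] bilinear_def
  by (auto intro!: linearI
      simp: vec_eq_iff matrix_matrix_mult_def sum.distrib sum_distrib_left algebra_simps)

lemma bounded_linear_transpose: "bounded_linear (transpose :: real^'n^'m \<Rightarrow> real^'m^'n)"
  unfolding linear_conv_bounded_linear[symmetric]
  by (auto intro!: linearI simp: vec_eq_iff transpose_def)

context
  fixes M :: "real^'n^'n" and m :: real
  assumes m: "m > 0" and bounded_below: "\<And>v. m * norm v \<le> norm (M *v v)"
begin

lemma matrix_mult_matrix_inv: "M *v (matrix_inv M *v b) = b"
proof -
  have "v = 0" if "M *v v = 0" for v
    using bounded_below[of v] that m by (simp add: mult_le_0_iff)
  then have "invertible M"
    by (simp add: invertible_left_inverse matrix_left_invertible_injective linear_injective_0)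
  then have "M ** matrix_inv M = mat 1"
    unfolding invertible_def matrix_inv_def by (rule someI2_ex) simp
  then show ?thesis
    by (simp add: matrix_vector_mul_assoc)
qed

lemma norm_matrix_inv_mult_le: "m * norm (matrix_inv M *v b) \<le> norm b"
  using bounded_below[of "matrix_inv M *v b"] by (simp add: matrix_mult_matrix_inv)

end

lemma lipschitzian_on_matrix_inv_mult:
  fixes M :: "'a::metric_space \<Rightarrow> real^'n^'n"
  assumes M: "lipschitzian_on D M" and b: "lipschitzian_on D b" and "bounded D"
    and m: "m > 0" and bounded_below: "\<And>x v. x \<in> D \<Longrightarrow> m * norm v \<le> norm (M x *v v)"
  shows "lipschitzian_on D (\<lambda>x. matrix_inv (M x) *v b x)"
proof -
  obtain L\<^sub>M L\<^sub>b where L\<^sub>M: "L\<^sub>M-lipschitz_on D M" and L\<^sub>b: "L\<^sub>b-lipschitz_on D b"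
    using M b by (auto simp: lipschitzian_on_def)
  obtain B where B: "B > 0" "\<And>x. x \<in> D \<Longrightarrow> norm (b x) \<le> B"
    using lipschitzian_on_imp_bounded[OF b \<open>bounded D\<close>] unfolding bounded_pos by auto
  let ?z = "\<lambda>x. matrix_inv (M x) *v b x"
  have "((L\<^sub>b + L\<^sub>M * (B / m)) / m)-lipschitz_on D ?z"
  proof (rule lipschitz_onI)
    fix x y assume x: "x \<in> D" and y: "y \<in> D"
    have z_le: "norm (?z y) \<le> B / m"
      using norm_matrix_inv_mult_le[OF m bounded_below[OF y], of "b y"] B(2)[OF y] m
      by (simp add: field_simps)
    have resolvent: "M x *v (?z x - ?z y) = (b x - b y) - (M x - M y) *v ?z y"
      by (simp add: matrix_vector_mult_diff_distrib matrix_vector_mult_diff_rdistrib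
          matrix_mult_matrix_inv[OF m bounded_below[OF x]]
          matrix_mult_matrix_inv[OF m bounded_below[OF y]])
    have "m * norm (?z x - ?z y) \<le> norm (b x - b y) + norm (M x - M y) * norm (?z y)"
      using bounded_below[OF x, of "?z x - ?z y", unfolded resolvent]
        norm_triangle_ineq4[of "b x - b y" "(M x - M y) *v ?z y"]
        norm_matrix_vector_mult_le[of "M x - M y" "?z y"] by linarith
    also have "\<dots> \<le> L\<^sub>b * dist x y + (L\<^sub>M * dist x y) * (B / m)"
      using lipschitz_onD[OF L\<^sub>b x y] lipschitz_onD[OF L\<^sub>M x y] lipschitz_on_nonneg[OF L\<^sub>M] z_le
      by (intro add_mono mult_mono) (auto simp: dist_norm)
    finally show "dist (?z x) (?z y) \<le> ((L\<^sub>b + L\<^sub>M * (B / m)) / m) * dist x y"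
      using m by (simp add: dist_norm field_simps)
  qed (use lipschitz_on_nonneg[OF L\<^sub>b] lipschitz_on_nonneg[OF L\<^sub>M] B m in simp)
  then show ?thesis
    by (rule lipschitzian_onI)
qed

definition regularized_gram :: "real^'n^'p \<Rightarrow> real \<Rightarrow> real^'p^'p" where
  "regularized_gram A c = A ** transpose A + c *\<^sub>R mat 1"

definition multiplier :: "real^'n^'p \<Rightarrow> real \<Rightarrow> real^'p \<Rightarrow> real^'p" where
  "multiplier A c b = matrix_inv (regularized_gram A c) *v b"

lemma regularized_gram_mult:
  fixes A :: "real^'n^'p"
  shows "regularized_gram A c *v v = A *v (v v* A) + c *\<^sub>R v"
  by (simp add: regularized_gram_def matrix_vector_mult_add_rdistrib matrix_vector_mul_assoc[symmetric]
      scaleR_matrix_vector_assoc[symmetric])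

lemma inner_regularized_gram:
  fixes A :: "real^'n^'p"
  shows "v \<bullet> (regularized_gram A c *v v) = (norm (v v* A))\<^sup>2 + c * (norm v)\<^sup>2"
  by (simp add: regularized_gram_mult inner_add_right dot_lmul_matrix[symmetric] power2_norm_eq_inner)

lemma regularized_gram_bounded_below:
  fixes A :: "real^'n^'p"
  assumes "m * (norm v)\<^sup>2 \<le> (norm (v v* A))\<^sup>2 + c * (norm v)\<^sup>2"
  shows "m * norm v \<le> norm (regularized_gram A c *v v)"
proof -
  have "m * (norm v)\<^sup>2 \<le> norm v * norm (regularized_gram A c *v v)"
    using assms norm_cauchy_schwarz[of v "regularized_gram A c *v v"] unfolding inner_regularized_gram
    by linarith
  then have "(m * norm v) * norm v \<le> norm (regularized_gram A c *v v) * norm v"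
    by (simp add: power2_eq_square algebra_simps)
  then show ?thesis
    by (cases "norm v = 0") (auto simp: mult_le_cancel_right)
qed

context
  fixes A :: "real^'n^'p" and c m :: real
  assumes m: "m > 0"
    and coercive: "\<And>v. m * (norm v)\<^sup>2 \<le> (norm (v v* A))\<^sup>2 + c * (norm v)\<^sup>2"
begin

lemma multiplier_eq: "A *v (multiplier A c b v* A) + c *\<^sub>R multiplier A c b = b"
  unfolding regularized_gram_mult[symmetric] unfolding multiplier_def
  by (rule matrix_mult_matrix_inv[OF m regularized_gram_bounded_below[OF coercive]])

lemma norm_multiplier_le: "m * norm (multiplier A c b) \<le> norm b"
  unfolding multiplier_def
  by (rule norm_matrix_inv_mult_le[OF m regularized_gram_bounded_below[OF coercive]])

lemma multiplier_energy_le: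
  "(norm (multiplier A c b v* A))\<^sup>2 + c * (norm (multiplier A c b))\<^sup>2 \<le>
    norm b * norm (multiplier A c b)"
  using norm_cauchy_schwarz[of "multiplier A c b" b] inner_regularized_gram[of "multiplier A c b" A c]
  by (simp add: regularized_gram_mult multiplier_eq mult.commute)

lemma norm_multiplier_mult_le_if_bounded_below:
  assumes "0 \<le> c" and "0 < \<kappa>" and "\<kappa> * norm (multiplier A c b) \<le> norm (multiplier A c b v* A)"
  shows "\<kappa> * norm (multiplier A c b v* A) \<le> norm b"
proof -
  let ?l = "multiplier A c b" let ?q = "norm (?l v* A)"
  have "0 \<le> c * (norm ?l)\<^sup>2"
    using \<open>0 \<le> c\<close> by simp
  then have "?q * ?q \<le> norm b * norm ?l"
    using multiplier_energy_le[of b] unfolding power2_eq_square by linarith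
  then have "\<kappa> * (?q * ?q) \<le> norm b * (\<kappa> * norm ?l)"
    using mult_left_mono[of _ _ \<kappa>] \<open>0 < \<kappa>\<close> by fastforce
  also have "\<dots> \<le> norm b * ?q"
    by (intro mult_left_mono assms) simp
  finally have "(\<kappa> * ?q) * ?q \<le> norm b * ?q"
    by (simp add: mult.assoc)
  then show ?thesis
    by (cases "?q = 0") (auto simp: mult_le_cancel_right)
qed

lemma norm_multiplier_mult_le_if_regularized:
  assumes "0 < c"
  shows "c * (norm (multiplier A c b v* A))\<^sup>2 \<le> (norm b)\<^sup>2"
proof -
  let ?l = "multiplier A c b" let ?q = "norm (?l v* A)"
  have "c * norm ?l \<le> norm b"
  proof (cases "norm ?l = 0")
    case False
    have "(c * norm ?l) * norm ?l \<le> norm b * norm ?l"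
      using multiplier_energy_le[of b] zero_le_power2[of ?q] unfolding power2_eq_square mult.assoc
      by linarith
    then show ?thesis
      using False by (simp add: mult_le_cancel_right)
  qed simp
  then have "norm b * (c * norm ?l) \<le> (norm b)\<^sup>2"
    unfolding power2_eq_square by (rule mult_left_mono) simp
  moreover have "c * ?q\<^sup>2 \<le> c * (norm b * norm ?l)"
  proof (rule mult_left_mono)
    have "0 \<le> c * (norm ?l)\<^sup>2"
      using \<open>0 < c\<close> by simp
    then show "?q\<^sup>2 \<le> norm b * norm ?l"
      using multiplier_energy_le[of b] by linarith
  qed (use \<open>0 < c\<close> in simp)
  ultimately show ?thesis
    by (simp add: mult_ac)
qed

end

lemma lipschitzian_on_multiplier:
  fixes A :: "'a::metric_space \<Rightarrow> real^'n^'p"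
  assumes A: "lipschitzian_on D A" and c: "lipschitzian_on D c" and b: "lipschitzian_on D b"
    and "bounded D" and "m > 0"
    and coercive: "\<And>x v. x \<in> D \<Longrightarrow> m * (norm v)\<^sup>2 \<le> (norm (v v* A x))\<^sup>2 + c x * (norm v)\<^sup>2"
  shows "lipschitzian_on D (\<lambda>x. multiplier (A x) (c x) (b x))"
  unfolding multiplier_def
proof (rule lipschitzian_on_matrix_inv_mult[OF _ b \<open>bounded D\<close> \<open>m > 0\<close>])
  show "lipschitzian_on D (\<lambda>x. regularized_gram (A x) (c x))"
    unfolding regularized_gram_def
    by (intro lipschitzian_intros A c \<open>bounded D\<close>
        bounded_bilinear.lipschitzian_on[OF bounded_bilinear_matrix_matrix_mult]
        bounded_bilinear.lipschitzian_on[OF bounded_bilinear_scaleR]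
        bounded_linear.lipschitzian_on[OF bounded_linear_transpose])
qed (rule regularized_gram_bounded_below[OF coercive])

section \<open>Maps of class \<open>C\<^sup>k\<close> flat along a set\<close>

lemma Ck_on_cong:
  assumes "open U" "\<And>x. x \<in> U \<Longrightarrow> f x = g x" "Ck_on k f U"
  shows "Ck_on k g U"
  using assms
proof (induction k arbitrary: f g)
  case 0
  then show ?case by (simp cong: continuous_on_cong)
next
  case (Suc k)
  have diff: "f differentiable at x" if "x \<in> U" for x
    using Suc.prems that by (simp add: differentiable_on_eq_differentiable_at)
  have eq: "frechet_derivative f (at x) = frechet_derivative g (at x)" if "x \<in> U" for x
    using frechet_derivative_transform_within_open[OF diff[OF that] Suc.prems(1) that Suc.prems(2)] .
  have "g differentiable at x" if "x \<in> U" for x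
    using diff[OF that] Suc.prems(1,2) that
    unfolding differentiable_def by (metis has_derivative_transform_within_open)
  moreover have "Ck_on k (\<lambda>x. frechet_derivative g (at x) v) U" for v
    by (rule Suc.IH[of "\<lambda>x. frechet_derivative f (at x) v"]) (use Suc.prems eq in auto)
  ultimately show ?case
    using Suc.prems(1) by (simp add: differentiable_on_eq_differentiable_at)
qed

lemma Ck_on_subset: "Ck_on k f U \<Longrightarrow> V \<subseteq> U \<Longrightarrow> Ck_on k f V"
proof (induction k arbitrary: f)
  case 0
  then show ?case by (auto intro: continuous_on_subset)
next
  case (Suc k)
  then show ?case by (auto intro: differentiable_on_subset)
qed

lemma Ck_on_SucD: "Ck_on (Suc k) f U \<Longrightarrow> Ck_on k f U"
proof (induction k arbitrary: f)
  case 0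
  then show ?case by (auto intro: differentiable_imp_continuous_on)
next
  case (Suc k)
  have "Ck_on k (\<lambda>x. frechet_derivative f (at x) v) U" for v
    by (rule Suc.IH) (use Suc.prems in auto)
  then show ?case using Suc.prems by simp
qed

lemma Ck_on_mono: "Ck_on k f U \<Longrightarrow> j \<le> k \<Longrightarrow> Ck_on j f U"
proof (induction k)
  case 0
  then show ?case by simp
next
  case (Suc k)
  show ?case
  proof (cases "j = Suc k")
    case False
    then show ?thesis using Suc.IH[OF Ck_on_SucD[OF Suc.prems(1)]] Suc.prems(2) by simp
  qed (use Suc.prems in simp)
qed

lemma Ck_on_frechet_derivative: "Ck_on (Suc k) f U \<Longrightarrow> Ck_on k (\<lambda>x. frechet_derivative f (at x) v) U"
  by simp

lemma Ck_on_differentiable: "Ck_on (Suc k) f U \<Longrightarrow> open U \<Longrightarrow> x \<in> U \<Longrightarrow> f differentiable at x"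
  by (simp add: differentiable_on_eq_differentiable_at)

lemma has_derivative_lincomb:
  assumes "f differentiable at x" "g differentiable at x"
  shows "((\<lambda>x. a *\<^sub>R f x + b *\<^sub>R g x) has_derivative
    (\<lambda>v. a *\<^sub>R frechet_derivative f (at x) v + b *\<^sub>R frechet_derivative g (at x) v)) (at x)"
  using assms unfolding frechet_derivative_works
  by (intro has_derivative_add has_derivative_scaleR_right)

lemma differentiable_lincomb:
  assumes "f differentiable at x" "g differentiable at x"
  shows "(\<lambda>x. a *\<^sub>R f x + b *\<^sub>R g x) differentiable at x"
  using has_derivative_lincomb[OF assms] differentiable_def by blast

lemma frechet_derivative_lincomb:
  assumes "f differentiable at x" "g differentiable at x"
  shows "frechet_derivative (\<lambda>x. a *\<^sub>R f x + b *\<^sub>R g x) (at x) =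
    (\<lambda>v. a *\<^sub>R frechet_derivative f (at x) v + b *\<^sub>R frechet_derivative g (at x) v)"
  using frechet_derivative_at[OF has_derivative_lincomb[OF assms]] by simp

lemma Ck_on_lincomb:
  assumes "open U" "Ck_on k f U" "Ck_on k g U"
  shows "Ck_on k (\<lambda>x. a *\<^sub>R f x + b *\<^sub>R g x) U"
  using assms(2,3)
proof (induction k arbitrary: f g)
  case 0
  then show ?case by (auto intro!: continuous_intros)
next
  case (Suc k)
  have diff: "f differentiable at x" "g differentiable at x" if "x \<in> U" for x
    using Suc.prems assms(1) that by (auto intro: Ck_on_differentiable)
  have "Ck_on k (\<lambda>x. a *\<^sub>R frechet_derivative f (at x) v + b *\<^sub>R frechet_derivative g (at x) v) U" for v
    by (rule Suc.IH) (use Suc.prems in auto)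
  then have "Ck_on k (\<lambda>x. frechet_derivative (\<lambda>x. a *\<^sub>R f x + b *\<^sub>R g x) (at x) v) U" for v
    by (rule Ck_on_cong[OF assms(1), rotated]) (simp add: frechet_derivative_lincomb diff)
  moreover have "(\<lambda>x. a *\<^sub>R f x + b *\<^sub>R g x) differentiable at x" if "x \<in> U" for x
    using differentiable_lincomb[OF diff[OF that]] .
  ultimately show ?case
    using assms(1) by (simp add: differentiable_on_eq_differentiable_at)
qed

lemma dderiv_snoc: "dderiv f (vs @ [v]) = dderiv (\<lambda>x. frechet_derivative f (at x) v) vs"
  by (induction vs) simp_all

lemma Ck_on_dderiv: "Ck_on (length vs + k) f U \<Longrightarrow> Ck_on k (dderiv f vs) U"
proof (induction vs arbitrary: f rule: rev_induct)
  case Nil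
  then show ?case by simp
next
  case (snoc v vs)
  show ?case
    unfolding dderiv_snoc by (rule snoc.IH) (use snoc.prems in auto)
qed

lemma dderiv_lincomb:
  assumes "open U" "Ck_on k f U" "Ck_on k g U" "length vs \<le> k" "x \<in> U"
  shows "dderiv (\<lambda>x. a *\<^sub>R f x + b *\<^sub>R g x) vs x = a *\<^sub>R dderiv f vs x + b *\<^sub>R dderiv g vs x"
  using assms(4,5)
proof (induction vs arbitrary: x)
  case Nil
  then show ?case by simp
next
  case (Cons v vs)
  have "Ck_on (Suc 0) (dderiv h vs) U" if "Ck_on k h U" for h :: "'a \<Rightarrow> 'b"
    by (rule Ck_on_dderiv, rule Ck_on_mono[OF that]) (use Cons.prems in simp)
  then have diff: "dderiv f vs differentiable at y" "dderiv g vs differentiable at y" if "y \<in> U" for y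
    using assms that Ck_on_differentiable by blast+
  let ?h = "\<lambda>y. a *\<^sub>R dderiv f vs y + b *\<^sub>R dderiv g vs y"
  have "?h differentiable at x"
    using differentiable_lincomb[OF diff[OF Cons.prems(2)]] .
  then have "frechet_derivative (dderiv (\<lambda>x. a *\<^sub>R f x + b *\<^sub>R g x) vs) (at x) =
      frechet_derivative ?h (at x)"
    by (rule frechet_derivative_transform_within_open[OF _ assms(1) Cons.prems(2), symmetric])
      (use Cons in simp)
  then show ?case
    using frechet_derivative_lincomb[OF diff[OF Cons.prems(2)]] by simp
qed

lemma norm_diff_le_partial_derivatives:
  fixes f :: "'a::euclidean_space \<Rightarrow> 'b::real_normed_vector"
  assumes "convex C" and diff: "\<And>z. z \<in> C \<Longrightarrow> f differentiable at z"
    and le: "\<And>z b. z \<in> C \<Longrightarrow> b \<in> Basis \<Longrightarrow> norm (frechet_derivative f (at z) b) \<le> K b"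
    and "x \<in> C" "y \<in> C"
  shows "norm (f x - f y) \<le> (\<Sum>b\<in>Basis. K b) * norm (x - y)"
proof (rule differentiable_bound[OF \<open>convex C\<close> _ _ \<open>x \<in> C\<close> \<open>y \<in> C\<close>])
  fix z assume z: "z \<in> C"
  have deriv: "(f has_derivative frechet_derivative f (at z)) (at z)"
    using diff[OF z] frechet_derivative_works by blast
  then show "(f has_derivative frechet_derivative f (at z)) (at z within C)"
    by (rule has_derivative_at_withinI)
  have "onorm (frechet_derivative f (at z)) \<le> (\<Sum>b\<in>Basis. norm (frechet_derivative f (at z) b))"
    using has_derivative_bounded_linear[OF deriv] by (rule onorm_componentwise)
  also have "\<dots> \<le> (\<Sum>b\<in>Basis. K b)"
    by (intro sum_mono le z)
  finally show "onorm (frechet_derivative f (at z)) \<le> (\<Sum>b\<in>Basis. K b)" .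
qed

lemma norm_le_power_Suc_of_partial_derivatives:
  fixes h :: "'a::euclidean_space \<Rightarrow> 'b::real_normed_vector"
  assumes "convex C" and diff: "\<And>z. z \<in> C \<Longrightarrow> h differentiable at z"
    and le: "\<And>z b. z \<in> C \<Longrightarrow> norm (frechet_derivative h (at z) b) \<le> K b * norm (z - y) ^ k"
    and K: "\<And>b. 0 \<le> K b" and "h y = 0" and x: "x \<in> C" and y: "y \<in> C"
  shows "norm (h x) \<le> (\<Sum>b\<in>Basis. K b) * norm (x - y) ^ Suc k"
proof -
  have seg: "closed_segment y x \<subseteq> C"
    using x y \<open>convex C\<close> by (simp add: closed_segment_subset)
  have "norm (h x - h y) \<le> (\<Sum>b\<in>Basis. K b * norm (x - y) ^ k) * norm (x - y)"
  proof (rule norm_diff_le_partial_derivatives[of "closed_segment y x"])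
    fix z b assume z: "z \<in> closed_segment y x"
    then show "h differentiable at z"
      using diff seg by blast
    have "norm (z - y) ^ k \<le> norm (x - y) ^ k"
      using segment_bound1[OF z] by (intro power_mono) auto
    from order_trans[OF le mult_left_mono[OF this K]]
    show "norm (frechet_derivative h (at z) b) \<le> K b * norm (x - y) ^ k"
      using z seg by blast
  qed auto
  then show ?thesis
    using \<open>h y = 0\<close> by (simp add: sum_distrib_right[symmetric] mult_ac)
qed

lemma continuous_on_compact_norm_bound:
  fixes f :: "'a::topological_space \<Rightarrow> 'b::real_normed_vector"
  assumes "compact C" and "continuous_on C f"
  obtains K where "K \<ge> 0" and "\<And>x. x \<in> C \<Longrightarrow> norm (f x) \<le> K"
  using compact_imp_bounded[OF compact_continuous_image[OF assms(2,1)]] unfolding bounded_pos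
  by (metis image_eqI less_imp_le)

lemma Ck_on_imp_lipschitzian_on:
  fixes f :: "'a::euclidean_space \<Rightarrow> 'b::real_normed_vector"
  assumes "open U" and f: "Ck_on (Suc 0) f U" and C: "compact C" "convex C" "C \<subseteq> U"
  shows "lipschitzian_on C f"
proof -
  have "continuous_on C (\<lambda>x. frechet_derivative f (at x) b)" for b
    using f C(3) by (auto intro: continuous_on_subset)
  then have "\<exists>K\<ge>0. \<forall>x\<in>C. norm (frechet_derivative f (at x) b) \<le> K" for b
    using continuous_on_compact_norm_bound[OF C(1)] by metis
  then obtain K where K: "\<And>b. K b \<ge> 0" "\<And>b x. x \<in> C \<Longrightarrow> norm (frechet_derivative f (at x) b) \<le> K b"
    by metis
  have "f differentiable at x" if "x \<in> C" for x
    using Ck_on_differentiable[OF f \<open>open U\<close>] that C(3) by auto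
  from norm_diff_le_partial_derivatives[OF C(2) this K(2)]
  have "(\<Sum>b\<in>Basis. K b)-lipschitz_on C f"
    by (intro lipschitz_onI sum_nonneg K(1)) (auto simp: dist_norm)
  then show ?thesis
    by (rule lipschitzian_onI)
qed

lemma vanishing_derivatives_imp_norm_le:
  fixes h :: "'a::euclidean_space \<Rightarrow> 'b::real_normed_vector"
  assumes "open U" and "Ck_on k h U" and C: "compact C" "convex C" "C \<subseteq> U"
    and "\<And>y vs. y \<in> S \<inter> C \<Longrightarrow> length vs < k \<Longrightarrow> dderiv h vs y = 0"
  shows "\<exists>K\<ge>0. \<forall>x\<in>C. \<forall>y\<in>S \<inter> C. norm (h x) \<le> K * norm (x - y) ^ k"
  using assms(2,6)
proof (induction k arbitrary: h)
  case 0
  then have "continuous_on C h"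
    using C(3) by (auto intro: continuous_on_subset)
  then show ?case
    using continuous_on_compact_norm_bound[OF C(1)] by (metis mult.right_neutral power_0)
next
  case (Suc k)
  let ?D = "\<lambda>b x. frechet_derivative h (at x) b"
  have "\<exists>K\<ge>0. \<forall>x\<in>C. \<forall>y\<in>S \<inter> C. norm (?D b x) \<le> K * norm (x - y) ^ k" for b
  proof (rule Suc.IH)
    show "Ck_on k (?D b) U"
      using Suc.prems(1) by simp
    show "dderiv (?D b) vs y = 0" if "y \<in> S \<inter> C" "length vs < k" for y vs
      using Suc.prems(2)[of y "vs @ [b]"] that by (simp add: dderiv_snoc)
  qed
  then obtain K where K: "\<And>b. K b \<ge> 0"
    "\<And>b x y. \<lbrakk>x \<in> C; y \<in> S \<inter> C\<rbrakk> \<Longrightarrow> norm (?D b x) \<le> K b * norm (x - y) ^ k"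
    by metis
  have "h differentiable at z" if "z \<in> C" for z
    using Ck_on_differentiable[OF Suc.prems(1) \<open>open U\<close>] that C(3) by auto
  moreover have "h y = 0" if "y \<in> S \<inter> C" for y
    using Suc.prems(2)[OF that, of "[]"] by simp
  ultimately have "norm (h x) \<le> (\<Sum>b\<in>Basis. K b) * norm (x - y) ^ Suc k" if "x \<in> C" "y \<in> S \<inter> C" for x y
    using that K by (intro norm_le_power_Suc_of_partial_derivatives[OF C(2)]) auto
  moreover have "(\<Sum>b\<in>Basis. K b) \<ge> 0"
    by (intro sum_nonneg K(1))
  ultimately show ?case
    by blast
qed

definition flat_along :: "nat \<Rightarrow> 'a::real_normed_vector set \<Rightarrow> ('a \<Rightarrow> 'b::real_normed_vector) \<Rightarrow> bool" where
  "flat_along k \<Sigma> h \<longleftrightarrow> (\<exists>U. open U \<and> 0 \<in> U \<and> Ck_on k h U \<and>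
     (\<forall>y\<in>\<Sigma> \<inter> U. \<forall>vs. length vs < k \<longrightarrow> dderiv h vs y = 0))"

lemma flat_along_frechet_derivative:
  assumes "flat_along (Suc k) \<Sigma> h"
  shows "flat_along k \<Sigma> (\<lambda>x. frechet_derivative h (at x) v)"
proof -
  obtain U where U: "open U" "0 \<in> U" "Ck_on (Suc k) h U"
    and flat: "\<And>y vs. y \<in> \<Sigma> \<inter> U \<Longrightarrow> length vs < Suc k \<Longrightarrow> dderiv h vs y = 0"
    using assms unfolding flat_along_def by blast
  have "dderiv (\<lambda>x. frechet_derivative h (at x) v) vs y = 0" if "y \<in> \<Sigma> \<inter> U" "length vs < k" for y vs
    using flat[OF that(1), of "vs @ [v]"] that(2) by (simp add: dderiv_snoc)
  with U show ?thesis
    unfolding flat_along_def by auto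
qed

lemma nearest_point_in_cball:
  fixes \<Sigma> :: "'a::euclidean_space set"
  assumes "closed \<Sigma>" "0 \<in> \<Sigma>" "x \<in> cball 0 (R / 2)"
  obtains y where "y \<in> \<Sigma> \<inter> cball 0 R" "infdist x \<Sigma> = norm (x - y)"
proof -
  obtain y where y: "y \<in> \<Sigma>" "infdist x \<Sigma> = dist x y"
    using infdist_attains_inf[OF assms(1)] assms(2) by blast
  moreover have "norm y \<le> R"
    using infdist_le_norm[OF assms(2), of x] y(2) norm_triangle_ineq4[of x "x - y"] assms(3)
    by (simp add: dist_norm)
  ultimately show ?thesis
    using that by (simp add: dist_norm)
qed

lemma flat_along_imp_norm_le:
  fixes h :: "'a::euclidean_space \<Rightarrow> 'b::real_normed_vector"
  assumes "closed \<Sigma>" "0 \<in> \<Sigma>" and "flat_along k \<Sigma> h"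
  obtains K where "K \<ge> 0" and "\<forall>\<^sub>F x in nhds 0. norm (h x) \<le> K * infdist x \<Sigma> ^ k"
proof -
  obtain U where U: "open U" "0 \<in> U" "Ck_on k h U"
    and flat: "\<And>y vs. y \<in> \<Sigma> \<inter> U \<Longrightarrow> length vs < k \<Longrightarrow> dderiv h vs y = 0"
    using assms(3) unfolding flat_along_def by blast
  obtain R where R: "R > 0" "cball 0 R \<subseteq> U"
    using U(1,2) open_contains_cball by blast
  have "\<exists>K\<ge>0. \<forall>x\<in>cball 0 R. \<forall>y\<in>\<Sigma> \<inter> cball 0 R. norm (h x) \<le> K * norm (x - y) ^ k"
    using flat R(2) by (intro vanishing_derivatives_imp_norm_le[OF U(1,3)]) auto
  then obtain K where K: "K \<ge> 0"
    "\<And>x y. \<lbrakk>x \<in> cball 0 R; y \<in> \<Sigma> \<inter> cball 0 R\<rbrakk> \<Longrightarrow> norm (h x) \<le> K * norm (x - y) ^ k"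
    by blast
  have "norm (h x) \<le> K * infdist x \<Sigma> ^ k" if "x \<in> ball 0 (R / 2)" for x
  proof -
    have "x \<in> cball 0 (R / 2)"
      using that by simp
    then obtain y where y: "y \<in> \<Sigma> \<inter> cball 0 R" "infdist x \<Sigma> = norm (x - y)"
      by (rule nearest_point_in_cball[OF assms(1,2)])
    have "x \<in> cball 0 R"
      using that R(1) by simp
    from K(2)[OF this y(1)] y(2) show ?thesis
      by simp
  qed
  then have "\<forall>\<^sub>F x in nhds 0. norm (h x) \<le> K * infdist x \<Sigma> ^ k"
    using R(1) by (intro eventually_nhds_in_open[of "ball 0 (R / 2)", THEN eventually_mono]) auto
  with K(1) show ?thesis
    by (rule that)
qed

definition jac :: "(real^'n \<Rightarrow> real^'p) \<Rightarrow> real^'n \<Rightarrow> real^'n^'p" where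
  "jac g x = (\<chi> i. grad_comp g i x)"

lemma jac_nth: "jac g x $ i $ k = frechet_derivative g (at x) (axis k 1) $ i"
  by (simp add: jac_def grad_comp_def)

lemma jac_mult:
  assumes "g differentiable at x"
  shows "jac g x *v v = frechet_derivative g (at x) v"
proof -
  have "jac g x = matrix (frechet_derivative g (at x))"
    by (simp add: vec_eq_iff jac_nth matrix_def)
  then show ?thesis
    using linear_frechet_derivative[OF assms] by (simp add: matrix_works linear_matrix_vector_mul_eq)
qed

lemma jac_diff:
  assumes "f differentiable at x" "g differentiable at x"
  shows "jac (\<lambda>x. f x - g x) x = jac f x - jac g x"
  using frechet_derivative_lincomb[OF assms, of 1 "- 1"] by (simp add: vec_eq_iff jac_nth)

lemma norm_jac_le:
  fixes g :: "real^'n \<Rightarrow> real^'p"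
  shows "norm (jac g x) \<le> real CARD('p) * (\<Sum>k\<in>UNIV. norm (frechet_derivative g (at x) (axis k 1)))"
proof -
  have "norm (jac g x $ i) \<le> (\<Sum>k\<in>UNIV. norm (frechet_derivative g (at x) (axis k 1)))" for i
  proof -
    have "norm (jac g x $ i) \<le> (\<Sum>k\<in>UNIV. \<bar>jac g x $ i $ k\<bar>)"
      by (rule norm_le_l1_cart)
    also have "\<dots> \<le> (\<Sum>k\<in>UNIV. norm (frechet_derivative g (at x) (axis k 1)))"
      unfolding jac_nth by (intro sum_mono component_le_norm_cart)
    finally show ?thesis .
  qed
  then have "(\<Sum>i\<in>(UNIV :: 'p set). norm (jac g x $ i)) \<le>
      real CARD('p) * (\<Sum>k\<in>UNIV. norm (frechet_derivative g (at x) (axis k 1)))"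
    by (intro sum_bounded_above) simp
  moreover have "norm (jac g x) \<le> (\<Sum>i\<in>(UNIV :: 'p set). norm (jac g x $ i))"
    unfolding norm_vec_def by (rule L2_set_le_sum) simp
  ultimately show ?thesis
    by linarith
qed

lemma flat_along_imp_norm_jac_le:
  fixes h :: "real^'n \<Rightarrow> real^'p"
  assumes "closed \<Sigma>" "0 \<in> \<Sigma>" and flat: "flat_along (Suc k) \<Sigma> h"
  obtains K where "K \<ge> 0" and "\<forall>\<^sub>F x in nhds 0. norm (jac h x) \<le> K * infdist x \<Sigma> ^ k"
proof -
  let ?D = "\<lambda>j x. norm (frechet_derivative h (at x) (axis j 1))"
  have "\<exists>K\<ge>0. \<forall>\<^sub>F x in nhds 0. ?D j x \<le> K * infdist x \<Sigma> ^ k" for j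
    using flat_along_imp_norm_le[OF assms(1,2) flat_along_frechet_derivative[OF flat]] by blast
  then have "\<forall>j. \<exists>K. 0 \<le> K \<and> (\<forall>\<^sub>F x in nhds 0. ?D j x \<le> K * infdist x \<Sigma> ^ k)"
    by blast
  from choice[OF this] obtain K where K: "\<And>j. K j \<ge> 0"
    "\<And>j. \<forall>\<^sub>F x in nhds 0. ?D j x \<le> K j * infdist x \<Sigma> ^ k"
    by blast
  have "\<forall>\<^sub>F x in nhds 0. \<forall>j. ?D j x \<le> K j * infdist x \<Sigma> ^ k"
    using K(2) by (rule eventually_all_finite)
  then have "\<forall>\<^sub>F x in nhds 0. norm (jac h x) \<le> (real CARD('p) * (\<Sum>j\<in>UNIV. K j)) * infdist x \<Sigma> ^ k"
  proof (rule eventually_mono)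
    fix x assume "\<forall>j. ?D j x \<le> K j * infdist x \<Sigma> ^ k"
    then have "(\<Sum>j\<in>UNIV. ?D j x) \<le> (\<Sum>j\<in>UNIV. K j) * infdist x \<Sigma> ^ k"
      unfolding sum_distrib_right by (intro sum_mono) simp
    from order_trans[OF norm_jac_le mult_left_mono[OF this]]
    show "norm (jac h x) \<le> (real CARD('p) * (\<Sum>j\<in>UNIV. K j)) * infdist x \<Sigma> ^ k"
      by (simp add: mult.assoc)
  qed
  moreover have "0 \<le> real CARD('p) * (\<Sum>j\<in>UNIV. K j)"
    by (intro mult_nonneg_nonneg sum_nonneg K(1)) simp
  ultimately show ?thesis
    using that by blast
qed

section \<open>Germs and their relative jets\<close>

lemma eventually_nhds_imp_eventually_cball:
  assumes "eventually P (nhds z)"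
  shows "\<forall>\<^sub>F \<rho> in at_right 0. \<forall>x\<in>cball z \<rho>. P x"
proof -
  obtain d where d: "d > 0" "\<And>x. dist x z < d \<Longrightarrow> P x"
    using assms unfolding eventually_nhds_metric by blast
  have "\<forall>\<^sub>F \<rho> in at_right 0. \<rho> < d"
    using d(1) by (auto simp: eventually_at_right_field)
  then show ?thesis
    by (rule eventually_mono) (use d(2) in \<open>auto simp: dist_commute\<close>)
qed

lemma germ_Cs_differentiable:
  assumes "germ_Cs (Suc s) g"
  shows "\<forall>\<^sub>F x in nhds 0. g differentiable at x"
  using assms Ck_on_differentiable unfolding germ_Cs_def eventually_nhds by blast

lemma germ_Cs_common_neighbourhood:
  assumes "germ_Cs s f" "germ_Cs s g"
  obtains U where "open U" "0 \<in> U" "Ck_on s f U" "Ck_on s g U"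
proof -
  obtain U V where "open U" "0 \<in> U" "Ck_on s f U" "open V" "0 \<in> V" "Ck_on s g V"
    using assms unfolding germ_Cs_def by blast
  then show ?thesis
    using that[of "U \<inter> V"] by (auto intro: Ck_on_subset)
qed

lemma germ_Cs_lincomb:
  assumes "germ_Cs s f" "germ_Cs s g"
  shows "germ_Cs s (\<lambda>x. a *\<^sub>R f x + b *\<^sub>R g x)"
proof -
  obtain U where U: "open U" "0 \<in> U" "Ck_on s f U" "Ck_on s g U"
    by (rule germ_Cs_common_neighbourhood[OF assms])
  have "a *\<^sub>R f 0 + b *\<^sub>R g 0 = 0"
    using assms by (simp add: germ_Cs_def)
  then show ?thesis
    unfolding germ_Cs_def using U(1,2) Ck_on_lincomb[OF U(1,3,4)] by blast
qed

lemma rel_jet_eq_affine_comb: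
  assumes "germ_Cs r g1" "germ_Cs r g2" and jets: "rel_jet_eq r \<Sigma> g1 f" "rel_jet_eq r \<Sigma> g2 f"
  shows "rel_jet_eq r \<Sigma> (\<lambda>x. (1 - t) *\<^sub>R g1 x + t *\<^sub>R g2 x) f"
proof -
  obtain U where U: "open U" "0 \<in> U" "Ck_on r g1 U" "Ck_on r g2 U"
    by (rule germ_Cs_common_neighbourhood[OF assms(1,2)])
  obtain V1 V2 where V: "open V1" "0 \<in> V1" "\<And>y. y \<in> \<Sigma> \<inter> V1 \<Longrightarrow> jet_eq_at r g1 f y"
    "open V2" "0 \<in> V2" "\<And>y. y \<in> \<Sigma> \<inter> V2 \<Longrightarrow> jet_eq_at r g2 f y"
    using jets unfolding rel_jet_eq_def by metis
  have "jet_eq_at r (\<lambda>x. (1 - t) *\<^sub>R g1 x + t *\<^sub>R g2 x) f y" if y: "y \<in> \<Sigma> \<inter> (U \<inter> V1 \<inter> V2)" for y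
    using V(3)[of y] V(6)[of y] dderiv_lincomb[OF U(1,3,4), of _ y "1 - t" t] y
    by (simp add: jet_eq_at_def scaleR_left_distrib[symmetric])
  then show ?thesis
    unfolding rel_jet_eq_def using U(1,2) V(1,2,4,5) by (intro exI[of _ "U \<inter> V1 \<inter> V2"]) auto
qed

lemma flat_along_diff_if_rel_jet_eq:
  assumes "germ_Cs (Suc r) f" "germ_Cs (Suc r) g" and jets: "rel_jet_eq r \<Sigma> g f"
  shows "flat_along (Suc r) \<Sigma> (\<lambda>x. g x - f x)"
proof -
  obtain U where U: "open U" "0 \<in> U" "Ck_on (Suc r) f U" "Ck_on (Suc r) g U"
    by (rule germ_Cs_common_neighbourhood[OF assms(1,2)])
  obtain V where V: "open V" "0 \<in> V" "\<And>y. y \<in> \<Sigma> \<inter> V \<Longrightarrow> jet_eq_at r g f y"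
    using jets unfolding rel_jet_eq_def by blast
  have "Ck_on (Suc r) (\<lambda>x. g x - f x) U"
    using Ck_on_lincomb[OF U(1,4,3), of 1 "- 1"] by simp
  then have "Ck_on (Suc r) (\<lambda>x. g x - f x) (U \<inter> V)"
    by (rule Ck_on_subset) simp
  moreover have "dderiv (\<lambda>x. g x - f x) vs y = 0" if "y \<in> \<Sigma> \<inter> (U \<inter> V)" "length vs < Suc r" for y vs
    using dderiv_lincomb[OF U(1,4,3), of vs y 1 "- 1"] V(3)[of y] that by (simp add: jet_eq_at_def)
  ultimately show ?thesis
    unfolding flat_along_def using U(1,2) V(1,2)
    by (intro exI[of _ "U \<inter> V"]) (auto simp del: Ck_on.simps)
qed

lemma rel_jet_eq_imp_norm_le:
  assumes \<Sigma>: "closed \<Sigma>" "0 \<in> \<Sigma>"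
    and germs: "germ_Cs (Suc r) f" "germ_Cs (Suc r) g" and "rel_jet_eq r \<Sigma> g f"
  obtains K where "K \<ge> 0" and "\<forall>\<^sub>F x in nhds 0. norm (g x - f x) \<le> K * infdist x \<Sigma> ^ Suc r"
    and "\<forall>\<^sub>F x in nhds 0. norm (jac g x - jac f x) \<le> K * infdist x \<Sigma> ^ r"
proof -
  note flat = flat_along_diff_if_rel_jet_eq[OF germs assms(5)]
  obtain K where K: "K \<ge> 0" "\<forall>\<^sub>F x in nhds 0. norm (g x - f x) \<le> K * infdist x \<Sigma> ^ Suc r"
    by (rule flat_along_imp_norm_le[OF \<Sigma> flat])
  obtain K' where K': "K' \<ge> 0" "\<forall>\<^sub>F x in nhds 0. norm (jac (\<lambda>x. g x - f x) x) \<le> K' * infdist x \<Sigma> ^ r"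
    by (rule flat_along_imp_norm_jac_le[OF \<Sigma> flat])
  have mono: "k * infdist x \<Sigma> ^ j \<le> max K K' * infdist x \<Sigma> ^ j" if "k \<le> max K K'" for k x j
    using that by (intro mult_right_mono) (auto simp: infdist_nonneg)
  show ?thesis
  proof (rule that[of "max K K'"])
    show "\<forall>\<^sub>F x in nhds 0. norm (g x - f x) \<le> max K K' * infdist x \<Sigma> ^ Suc r"
      using K(2) by (rule eventually_mono) (meson mono order_trans max.cobounded1)
    show "\<forall>\<^sub>F x in nhds 0. norm (jac g x - jac f x) \<le> max K K' * infdist x \<Sigma> ^ r"
      using K'(2) germ_Cs_differentiable[OF germs(1)] germ_Cs_differentiable[OF germs(2)]
    proof eventually_elim
      case (elim x)
      then show ?case
        using mono[of K' x r] by (simp add: jac_diff)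
    qed
  qed (use K(1) in simp)
qed

lemma germ_Cs_lipschitzian_on:
  assumes "germ_Cs (Suc s) g"
  shows "\<forall>\<^sub>F \<rho> in at_right 0. lipschitzian_on (cball 0 \<rho>) g"
proof -
  obtain U where U: "open U" "0 \<in> U" "Ck_on (Suc s) g U"
    using assms unfolding germ_Cs_def by blast
  have "\<forall>\<^sub>F \<rho> in at_right 0. \<forall>x\<in>cball 0 \<rho>. x \<in> U"
    using U(1,2) by (intro eventually_nhds_imp_eventually_cball eventually_nhds_in_open)
  then show ?thesis
    by (rule eventually_mono)
      (use Ck_on_mono[OF U(3), of "Suc 0"] in \<open>auto intro!: Ck_on_imp_lipschitzian_on[OF U(1)]\<close>)
qed

lemma germ_Cs_lipschitzian_on_jac:
  fixes g :: "real^'n \<Rightarrow> real^'p"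
  assumes "germ_Cs (Suc (Suc s)) g"
  shows "\<forall>\<^sub>F \<rho> in at_right 0. lipschitzian_on (cball 0 \<rho>) (jac g)"
proof -
  obtain U where U: "open U" "0 \<in> U" "Ck_on (Suc (Suc s)) g U"
    using assms unfolding germ_Cs_def by blast
  have Ck: "Ck_on (Suc 0) (\<lambda>x. frechet_derivative g (at x) v) U" for v
    by (rule Ck_on_mono[OF Ck_on_frechet_derivative[OF U(3)]]) simp
  have "\<forall>\<^sub>F \<rho> in at_right 0. \<forall>x\<in>cball 0 \<rho>. x \<in> U"
    using U(1,2) by (intro eventually_nhds_imp_eventually_cball eventually_nhds_in_open)
  then show ?thesis
  proof (rule eventually_mono)
    fix \<rho> :: real assume "\<forall>x\<in>cball 0 \<rho>. x \<in> U"
    then have "lipschitzian_on (cball 0 \<rho>) (\<lambda>x. frechet_derivative g (at x) v)" for v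
      by (intro Ck_on_imp_lipschitzian_on[OF U(1) Ck]) auto
    then have "lipschitzian_on (cball 0 \<rho>) (\<lambda>x. jac g x $ i $ k)" for i k
      unfolding jac_nth by (rule bounded_linear.lipschitzian_on[OF bounded_linear_vec_nth])
    then show "lipschitzian_on (cball 0 \<rho>) (jac g)"
      by (intro lipschitzian_on_vec)
  qed
qed

section \<open>The Kuo condition along a segment of realisations\<close>

lemma infdist_span_others_le:
  fixes g :: "'i::finite \<Rightarrow> 'a::real_normed_vector"
  shows "\<bar>c i\<bar> * infdist (g i) (span {g j | j. j \<noteq> i}) \<le> norm (\<Sum>j\<in>UNIV. c j *\<^sub>R g j)"
proof (cases "c i = 0")
  case False
  let ?s = "- (\<Sum>j\<in>UNIV - {i}. (c j / c i) *\<^sub>R g j)"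
  have "infdist (g i) (span {g j | j. j \<noteq> i}) \<le> dist (g i) ?s"
    by (intro infdist_le span_neg span_sum span_scale span_base) auto
  also have "dist (g i) ?s = norm ((1 / c i) *\<^sub>R (\<Sum>j\<in>UNIV. c j *\<^sub>R g j))"
    using False by (simp add: dist_norm sum.remove[of UNIV i] scaleR_right_distrib scaleR_sum_right)
  finally show ?thesis
    using False by (simp add: field_simps)
qed simp

lemma norm_le_card_mult_component:
  fixes v :: "real^'p"
  obtains i where "norm v \<le> real CARD('p) * \<bar>v $ i\<bar>"
proof -
  have "Max (range (\<lambda>i. \<bar>v $ i\<bar>)) \<in> range (\<lambda>i. \<bar>v $ i\<bar>)"
    by (rule Max_in) auto
  then obtain i where "Max (range (\<lambda>i. \<bar>v $ i\<bar>)) = \<bar>v $ i\<bar>"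
    by (rule imageE)
  then have max: "\<bar>v $ j\<bar> \<le> \<bar>v $ i\<bar>" for j
    using Max_ge[of "range (\<lambda>i. \<bar>v $ i\<bar>)" "\<bar>v $ j\<bar>"] by simp
  have "norm v \<le> (\<Sum>j\<in>UNIV. \<bar>v $ j\<bar>)"
    by (rule norm_le_l1_cart)
  also have "\<dots> \<le> (\<Sum>j\<in>(UNIV :: 'p set). \<bar>v $ i\<bar>)"
    by (intro sum_mono max)
  finally show ?thesis
    using that by simp
qed

lemma kappa_nonneg: "0 \<le> kappa f x"
  unfolding kappa_def by (subst Min_ge_iff) (auto simp: infdist_nonneg)

lemma kappa_mult_norm_le:
  fixes f :: "real^'n \<Rightarrow> real^'p"
  shows "kappa f x * norm v \<le> real CARD('p) * norm (v v* jac f x)"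
proof -
  let ?g = "\<lambda>i. grad_comp f i x"
  obtain i where "norm v \<le> real CARD('p) * \<bar>v $ i\<bar>"
    by (rule norm_le_card_mult_component)
  then have "kappa f x * norm v \<le> real CARD('p) * (\<bar>v $ i\<bar> * kappa f x)"
    using mult_left_mono[OF _ kappa_nonneg] by (metis mult.assoc mult.commute)
  also have "\<bar>v $ i\<bar> * kappa f x \<le> \<bar>v $ i\<bar> * infdist (?g i) (span {?g j | j. j \<noteq> i})"
    unfolding kappa_def by (intro mult_left_mono Min_le) auto
  also have "\<dots> \<le> norm (\<Sum>j\<in>UNIV. v $ j *\<^sub>R ?g j)"
    by (rule infdist_span_others_le)
  also have "(\<Sum>j\<in>UNIV. v $ j *\<^sub>R ?g j) = v v* jac f x"
    by (simp add: vec_eq_iff vector_matrix_mult_def jac_def mult.commute)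
  finally show ?thesis
    by simp
qed

lemma norm_vector_matrix_mult_ge_near_jac:
  fixes f :: "real^'n \<Rightarrow> real^'p"
  assumes kappa: "real CARD('p) * ((K + 1) * c) \<le> kappa f x" and J: "norm (J - jac f x) \<le> K * c"
  shows "c * norm v \<le> norm (v v* J)"
proof -
  have "real CARD('p) * ((K + 1) * c * norm v) \<le> kappa f x * norm v"
    using mult_right_mono[OF kappa, of "norm v"] by (simp add: mult.assoc)
  from order_trans[OF this kappa_mult_norm_le] have "(K + 1) * c * norm v \<le> norm (v v* jac f x)"
    by (simp add: mult_le_cancel_left)
  then have "K * c * norm v + c * norm v \<le> norm (v v* jac f x)"
    by (simp add: distrib_right)
  moreover have "norm (v v* (J - jac f x)) \<le> K * c * norm v"
    by (intro order_trans[OF norm_vector_matrix_mult_le] mult_right_mono J) simp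
  moreover have "norm (v v* jac f x) - norm (v v* (J - jac f x)) \<le> norm (v v* J)"
    using norm_diff_ineq[of "v v* jac f x" "v v* (J - jac f x)"]
    by (simp add: vector_matrix_mult_diff_rdistrib)
  ultimately show ?thesis
    by linarith
qed

lemma eventually_power_le_powr:
  fixes \<Sigma> :: "'a::real_normed_vector set"
  assumes "0 \<in> \<Sigma>" and "r \<ge> 1" and "C > 0" and "\<delta> > 0"
  shows "\<forall>\<^sub>F x in nhds 0. c * infdist x \<Sigma> ^ r \<le> C * infdist x \<Sigma> powr (real r - \<delta>)"
proof -
  have "((\<lambda>x. infdist x \<Sigma>) \<longlongrightarrow> 0) (nhds 0)"
    using tendsto_infdist[OF filterlim_ident, where A = \<Sigma> and l = 0] \<open>0 \<in> \<Sigma>\<close> by simp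
  then have "((\<lambda>x. c * infdist x \<Sigma> powr \<delta>) \<longlongrightarrow> c * 0) (nhds 0)"
    using \<open>\<delta> > 0\<close>
    by (intro tendsto_mult tendsto_const tendsto_zero_powrI[where b = \<delta>]) (auto simp: infdist_nonneg)
  then have "\<forall>\<^sub>F x in nhds 0. c * infdist x \<Sigma> powr \<delta> < C"
    by (rule order_tendstoD) (use \<open>C > 0\<close> in simp)
  then show ?thesis
  proof (rule eventually_mono)
    fix x assume small: "c * infdist x \<Sigma> powr \<delta> < C"
    show "c * infdist x \<Sigma> ^ r \<le> C * infdist x \<Sigma> powr (real r - \<delta>)"
    proof (cases "infdist x \<Sigma> = 0")
      case False
      then have "infdist x \<Sigma> ^ r = infdist x \<Sigma> powr \<delta> * infdist x \<Sigma> powr (real r - \<delta>)"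
        using infdist_nonneg[of x \<Sigma>] by (simp add: powr_add[symmetric] powr_realpow)
      then show ?thesis
        using mult_right_mono[OF less_imp_le[OF small], of "infdist x \<Sigma> powr (real r - \<delta>)"]
        by (simp add: mult.assoc)
    qed (use \<open>r \<ge> 1\<close> in \<open>simp add: power_0_left\<close>)
  qed
qed

definition linear_homotopy :: "('a \<Rightarrow> 'b) \<Rightarrow> ('a \<Rightarrow> 'b) \<Rightarrow> real \<Rightarrow> 'a \<Rightarrow> 'b::real_vector" where
  "linear_homotopy a b t x = (1 - t) *\<^sub>R a x + t *\<^sub>R b x"

lemma linear_homotopy_0 [simp]: "linear_homotopy a b 0 x = a x"
  and linear_homotopy_1 [simp]: "linear_homotopy a b 1 x = b x"
  by (simp_all add: linear_homotopy_def)

lemma norm_linear_homotopy_diff_time: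
  fixes a b :: "'a \<Rightarrow> 'b::real_normed_vector"
  shows "norm (linear_homotopy a b s x - linear_homotopy a b t x) = \<bar>s - t\<bar> * norm (b x - a x)"
proof -
  have "linear_homotopy a b s x - linear_homotopy a b t x = (s - t) *\<^sub>R (b x - a x)"
    by (simp add: linear_homotopy_def algebra_simps)
  then show ?thesis
    by simp
qed

lemma norm_linear_homotopy_diff_le:
  fixes a b :: "'a \<Rightarrow> 'b::real_normed_vector"
  assumes "t \<in> {0..1}" and "norm (a x - c) \<le> K" and "norm (b x - c) \<le> K"
  shows "norm (linear_homotopy a b t x - c) \<le> K"
proof -
  have "(1 - t) *\<^sub>R a x + t *\<^sub>R b x \<in> cball c K"
    using assms by (intro convexD[OF convex_cball]) (auto simp: dist_norm norm_minus_commute)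
  then show ?thesis
    by (simp add: linear_homotopy_def dist_norm norm_minus_commute)
qed

definition nondegenerate_on_horn ::
  "(real^'n) set \<Rightarrow> nat \<Rightarrow> (real^'n \<Rightarrow> 'b::real_normed_vector) \<Rightarrow> (real^'n \<Rightarrow> real^'n^'p) \<Rightarrow>
    real \<Rightarrow> bool" where
  "nondegenerate_on_horn \<Sigma> r F A \<epsilon> \<longleftrightarrow>
     (\<forall>x v. norm x < \<epsilon> \<longrightarrow> x \<in> horn \<Sigma> (Suc r) F \<epsilon> \<longrightarrow> infdist x \<Sigma> ^ r * norm v \<le> norm (v v* A x))"

lemma horn_mono: "w \<le> w' \<Longrightarrow> horn \<Sigma> d g w \<subseteq> horn \<Sigma> d g w'"
  unfolding horn_def by (auto intro: order_trans[OF _ mult_right_mono] simp: infdist_nonneg)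

lemma horn_linear_homotopy:
  fixes g1 g2 :: "'a::metric_space \<Rightarrow> 'b::real_normed_vector"
  assumes flat: "norm (g2 x - g1 x) \<le> K * infdist x \<Sigma> ^ d" and close: "\<bar>s - t\<bar> * K \<le> w / 2"
    and s: "x \<in> horn \<Sigma> d (linear_homotopy g1 g2 s) (w / 2)"
  shows "x \<in> horn \<Sigma> d (linear_homotopy g1 g2 t) w"
proof -
  let ?F = "linear_homotopy g1 g2"
  have "norm (?F t x - ?F s x) \<le> (\<bar>s - t\<bar> * K) * infdist x \<Sigma> ^ d"
    using mult_left_mono[OF flat, of "\<bar>s - t\<bar>"]
    unfolding norm_linear_homotopy_diff_time by (simp add: abs_minus_commute mult.assoc)
  also have "\<dots> \<le> w / 2 * infdist x \<Sigma> ^ d"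
    using close by (intro mult_right_mono zero_le_power infdist_nonneg)
  finally show ?thesis
    using s norm_triangle_sub[of "?F t x" "?F s x"] by (simp add: horn_def)
qed

lemma nondegenerate_on_horn_mono:
  "nondegenerate_on_horn \<Sigma> r F A \<epsilon> \<Longrightarrow> \<epsilon>' \<le> \<epsilon> \<Longrightarrow> nondegenerate_on_horn \<Sigma> r F A \<epsilon>'"
  unfolding nondegenerate_on_horn_def using horn_mono[of \<epsilon>' \<epsilon>] by (meson less_le_trans subsetD)

lemma compact_uniform_positive:
  fixes P :: "'a::topological_space \<Rightarrow> real \<Rightarrow> bool"
  assumes "compact K"
    and local: "\<And>t. t \<in> K \<Longrightarrow> \<exists>\<epsilon>>0. \<forall>\<^sub>F s in nhds t. s \<in> K \<longrightarrow> P s \<epsilon>"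
    and mono: "\<And>t \<epsilon> \<epsilon>'. P t \<epsilon> \<Longrightarrow> \<epsilon>' \<le> \<epsilon> \<Longrightarrow> P t \<epsilon>'"
  obtains \<epsilon> where "\<epsilon> > 0" and "\<And>t. t \<in> K \<Longrightarrow> P t \<epsilon>"
proof -
  let ?V = "\<lambda>\<epsilon>. interior {s. s \<in> K \<longrightarrow> P s \<epsilon>}"
  have "K \<subseteq> (\<Union>\<epsilon>\<in>{0<..}. ?V \<epsilon>)"
  proof
    fix t assume "t \<in> K"
    from local[OF this] show "t \<in> (\<Union>\<epsilon>\<in>{0<..}. ?V \<epsilon>)"
      unfolding eventually_nhds interior_def by blast
  qed
  then obtain E where E: "E \<subseteq> {0<..}" "finite E" "K \<subseteq> (\<Union>\<epsilon>\<in>E. ?V \<epsilon>)"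
    using compactE_image[OF \<open>compact K\<close>, of "{0<..}" ?V] by auto
  show ?thesis
  proof (rule that[of "Min (insert 1 E)"])
    show "Min (insert 1 E) > 0"
      using E(1,2) by auto
    fix t assume "t \<in> K"
    then obtain \<epsilon> where "\<epsilon> \<in> E" "t \<in> ?V \<epsilon>"
      using E(3) by blast
    then have "P t \<epsilon>"
      using interior_subset \<open>t \<in> K\<close> by blast
    moreover have "Min (insert 1 E) \<le> \<epsilon>"
      using \<open>\<epsilon> \<in> E\<close> E(2) by (intro Min_le) auto
    ultimately show "P t (Min (insert 1 E))"
      by (rule mono)
  qed
qed

locale realisation_pair =
  fixes \<Sigma> :: "(real^'n) set" and r :: nat and f g1 g2 :: "real^'n \<Rightarrow> real^'p"
  assumes closed: "closed \<Sigma>" and zero: "0 \<in> \<Sigma>" and r: "r \<ge> 1"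
    and germ_f: "germ_Cs (Suc r) f" and germ_g1: "germ_Cs (Suc r) g1" and germ_g2: "germ_Cs (Suc r) g2"
    and jet_g1: "rel_jet_eq r \<Sigma> g1 f" and jet_g2: "rel_jet_eq r \<Sigma> g2 f"
    and kuo: "rel_kuo_delta \<Sigma> r f"
begin

abbreviation "F \<equiv> linear_homotopy g1 g2"
abbreviation "A \<equiv> linear_homotopy (jac g1) (jac g2)"

lemma kuo_linear_homotopy:
  "\<exists>C \<alpha> \<delta> w. C > 0 \<and> \<alpha> > 0 \<and> \<delta> > 0 \<and> w > 0 \<and>
    (\<forall>x \<in> horn \<Sigma> (Suc r) (F t) w \<inter> {x. norm x < \<alpha>}. C * infdist x \<Sigma> powr (real r - \<delta>) \<le> kappa f x)"
proof -
  have "germ_Cs (Suc r) (F t)"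
    unfolding linear_homotopy_def[abs_def] by (rule germ_Cs_lincomb[OF germ_g1 germ_g2])
  moreover have "germ_Cs r g1" "germ_Cs r g2"
    using germ_g1 germ_g2 Ck_on_SucD unfolding germ_Cs_def by blast+
  then have "rel_jet_eq r \<Sigma> (F t) f"
    unfolding linear_homotopy_def[abs_def] using jet_g1 jet_g2 by (rule rel_jet_eq_affine_comb)
  ultimately show ?thesis
    using kuo unfolding rel_kuo_delta_def by simp
qed

lemma flat_near_0:
  obtains K where "K \<ge> 0" and "\<forall>\<^sub>F x in nhds 0. norm (g2 x - g1 x) \<le> K * infdist x \<Sigma> ^ Suc r"
    and "\<forall>\<^sub>F x in nhds 0. \<forall>t\<in>{0..1}. norm (A t x - jac f x) \<le> K * infdist x \<Sigma> ^ r"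
proof -
  obtain K1 where K1: "K1 \<ge> 0" "\<forall>\<^sub>F x in nhds 0. norm (g1 x - f x) \<le> K1 * infdist x \<Sigma> ^ Suc r"
    "\<forall>\<^sub>F x in nhds 0. norm (jac g1 x - jac f x) \<le> K1 * infdist x \<Sigma> ^ r"
    by (rule rel_jet_eq_imp_norm_le[OF closed zero germ_f germ_g1 jet_g1])
  obtain K2 where K2: "K2 \<ge> 0" "\<forall>\<^sub>F x in nhds 0. norm (g2 x - f x) \<le> K2 * infdist x \<Sigma> ^ Suc r"
    "\<forall>\<^sub>F x in nhds 0. norm (jac g2 x - jac f x) \<le> K2 * infdist x \<Sigma> ^ r"
    by (rule rel_jet_eq_imp_norm_le[OF closed zero germ_f germ_g2 jet_g2])
  show ?thesis
  proof (rule that[of "K1 + K2"])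
    show "\<forall>\<^sub>F x in nhds 0. norm (g2 x - g1 x) \<le> (K1 + K2) * infdist x \<Sigma> ^ Suc r"
      using K1(2) K2(2)
    proof eventually_elim
      case (elim x)
      then show ?case
        using norm_triangle_ineq4[of "g2 x - f x" "g1 x - f x"] unfolding distrib_right by simp
    qed
    show "\<forall>\<^sub>F x in nhds 0. \<forall>t\<in>{0..1}. norm (A t x - jac f x) \<le> (K1 + K2) * infdist x \<Sigma> ^ r"
      using K1(3) K2(3)
    proof eventually_elim
      case (elim x)
      have "0 \<le> K1 * infdist x \<Sigma> ^ r" "0 \<le> K2 * infdist x \<Sigma> ^ r"
        using K1(1) K2(1) by (simp_all add: infdist_nonneg)
      with elim show ?case
        unfolding distrib_right by (intro ballI norm_linear_homotopy_diff_le) auto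
    qed
  qed (use K1(1) K2(1) in simp)
qed

lemma estimates_near_0:
  assumes "C > 0" and "\<delta> > 0"
  obtains K \<beta> where "\<beta> > 0" and "\<forall>x\<in>ball 0 \<beta>. norm (g2 x - g1 x) \<le> K * infdist x \<Sigma> ^ Suc r"
    and "\<forall>x\<in>ball 0 \<beta>. \<forall>t\<in>{0..1}. norm (A t x - jac f x) \<le> K * infdist x \<Sigma> ^ r"
    and "\<forall>x\<in>ball 0 \<beta>. real CARD('p) * (K + 1) * infdist x \<Sigma> ^ r \<le> C * infdist x \<Sigma> powr (real r - \<delta>)"
proof -
  obtain K where "\<forall>\<^sub>F x in nhds 0. norm (g2 x - g1 x) \<le> K * infdist x \<Sigma> ^ Suc r"
    and "\<forall>\<^sub>F x in nhds 0. \<forall>t\<in>{0..1}. norm (A t x - jac f x) \<le> K * infdist x \<Sigma> ^ r"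
    by (rule flat_near_0)
  then have "\<forall>\<^sub>F x in nhds 0. norm (g2 x - g1 x) \<le> K * infdist x \<Sigma> ^ Suc r \<and>
      (\<forall>t\<in>{0..1}. norm (A t x - jac f x) \<le> K * infdist x \<Sigma> ^ r) \<and>
      real CARD('p) * (K + 1) * infdist x \<Sigma> ^ r \<le> C * infdist x \<Sigma> powr (real r - \<delta>)"
    by (intro eventually_conj eventually_power_le_powr zero r assms)
  then obtain \<beta> where "\<beta> > 0" and "\<forall>x\<in>ball 0 \<beta>. norm (g2 x - g1 x) \<le> K * infdist x \<Sigma> ^ Suc r \<and>
      (\<forall>t\<in>{0..1}. norm (A t x - jac f x) \<le> K * infdist x \<Sigma> ^ r) \<and>
      real CARD('p) * (K + 1) * infdist x \<Sigma> ^ r \<le> C * infdist x \<Sigma> powr (real r - \<delta>)"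
    unfolding eventually_nhds_metric by (auto simp: dist_commute)
  then show ?thesis
    by (intro that[of \<beta> K]) blast+
qed

lemma nondegenerate_locally:
  "\<exists>\<epsilon>>0. \<forall>\<^sub>F s in nhds t. s \<in> {0..1} \<longrightarrow> nondegenerate_on_horn \<Sigma> r (F s) (A s) \<epsilon>"
proof -
  obtain C \<alpha> \<delta> w where pos: "C > 0" "\<alpha> > 0" "\<delta> > 0" "w > 0" and
    kuo_t: "\<forall>x \<in> horn \<Sigma> (Suc r) (F t) w \<inter> {x. norm x < \<alpha>}.
      C * infdist x \<Sigma> powr (real r - \<delta>) \<le> kappa f x"
    using kuo_linear_homotopy by blast
  obtain K \<beta> where "\<beta> > 0" and flat: "\<forall>x\<in>ball 0 \<beta>. norm (g2 x - g1 x) \<le> K * infdist x \<Sigma> ^ Suc r"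
    and flat_jac: "\<forall>x\<in>ball 0 \<beta>. \<forall>s\<in>{0..1}. norm (A s x - jac f x) \<le> K * infdist x \<Sigma> ^ r"
    and power_le: "\<forall>x\<in>ball 0 \<beta>.
      real CARD('p) * (K + 1) * infdist x \<Sigma> ^ r \<le> C * infdist x \<Sigma> powr (real r - \<delta>)"
    by (rule estimates_near_0[OF pos(1,3)])
  define \<epsilon> where "\<epsilon> = min (min \<alpha> \<beta>) (w / 2)"
  have "nondegenerate_on_horn \<Sigma> r (F s) (A s) \<epsilon>" if s: "s \<in> {0..1}" "\<bar>s - t\<bar> * K < w / 2" for s
    unfolding nondegenerate_on_horn_def
  proof (intro allI impI)
    fix x :: "real^'n" and v :: "real^'p"
    assume "norm x < \<epsilon>" and "x \<in> horn \<Sigma> (Suc r) (F s) \<epsilon>"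
    moreover have "\<epsilon> \<le> w / 2"
      by (simp add: \<epsilon>_def)
    ultimately have x: "norm x < \<alpha>" "x \<in> ball 0 \<beta>" and horn: "x \<in> horn \<Sigma> (Suc r) (F s) (w / 2)"
      using horn_mono[of \<epsilon> "w / 2"] by (auto simp: \<epsilon>_def)
    have "x \<in> horn \<Sigma> (Suc r) (F t) w"
      by (rule horn_linear_homotopy[OF bspec[OF flat x(2)] _ horn]) (use s(2) in simp)
    then have "real CARD('p) * (K + 1) * infdist x \<Sigma> ^ r \<le> kappa f x"
      using order_trans[OF bspec[OF power_le x(2)] bspec[OF kuo_t]] x(1) by blast
    moreover have "norm (A s x - jac f x) \<le> K * infdist x \<Sigma> ^ r"
      using flat_jac x(2) s(1) by blast
    ultimately show "infdist x \<Sigma> ^ r * norm v \<le> norm (v v* A s x)"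
      by (intro norm_vector_matrix_mult_ge_near_jac) (simp_all add: mult.assoc)
  qed
  moreover have "((\<lambda>s. \<bar>s - t\<bar> * K) \<longlongrightarrow> \<bar>t - t\<bar> * K) (nhds t)"
    by (intro tendsto_intros filterlim_ident)
  then have "\<forall>\<^sub>F s in nhds t. \<bar>s - t\<bar> * K < w / 2"
    by (rule order_tendstoD) (use pos(4) in simp)
  ultimately show ?thesis
    using pos \<open>\<beta> > 0\<close> by (intro exI[of _ \<epsilon>]) (auto simp: \<epsilon>_def elim: eventually_mono)
qed

lemma nondegenerate_uniformly:
  obtains \<epsilon> where "\<epsilon> > 0" and "\<And>t. t \<in> {0..1} \<Longrightarrow> nondegenerate_on_horn \<Sigma> r (F t) (A t) \<epsilon>"
  by (rule compact_uniform_positive[OF compact_Icc nondegenerate_locally])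
    (auto intro: nondegenerate_on_horn_mono)

end

section \<open>The vector field along the homotopy\<close>

lemma lipschitzian_on_linear_homotopy:
  fixes a b :: "'a::metric_space \<Rightarrow> 'b::real_normed_vector"
  assumes a: "lipschitzian_on D a" and b: "lipschitzian_on D b" and "bounded D"
  shows "lipschitzian_on ({0..1} \<times> D) (\<lambda>p. linear_homotopy a b (fst p) (snd p))"
proof -
  let ?E = "{0..1::real} \<times> D"
  have "lipschitzian_on ?E (\<lambda>p. a (snd p))" "lipschitzian_on ?E (\<lambda>p. b (snd p))"
    by (auto intro!: lipschitzian_on_compose[OF a] lipschitzian_on_compose[OF b] lipschitzian_intros)
  moreover have "bounded ?E"
    using \<open>bounded D\<close> by (intro bounded_Times) auto
  ultimately show ?thesis
    unfolding linear_homotopy_def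
    by (intro lipschitzian_intros bounded_bilinear.lipschitzian_on[OF bounded_bilinear_scaleR])
qed

lemma has_vector_derivative_along_curve:
  fixes g :: "real^'n \<Rightarrow> real^'p"
  assumes "g differentiable at (u t)" and "(u has_vector_derivative u') (at t within T)"
  shows "((\<lambda>t. g (u t)) has_vector_derivative jac g (u t) *v u') (at t within T)"
proof -
  have "(g has_derivative frechet_derivative g (at (u t))) (at (u t) within u ` T)"
    using assms(1) frechet_derivative_works has_derivative_at_withinI by blast
  from vector_derivative_diff_chain_within[OF assms(2) this] show ?thesis
    by (simp add: o_def jac_mult[OF assms(1)])
qed

lemma has_vector_derivative_linear_homotopy:
  fixes g1 g2 :: "real^'n \<Rightarrow> real^'p"
  assumes "g1 differentiable at (u t)" "g2 differentiable at (u t)"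
    and u: "(u has_vector_derivative u') (at t within T)"
  shows "((\<lambda>t. linear_homotopy g1 g2 t (u t)) has_vector_derivative
    linear_homotopy (jac g1) (jac g2) t (u t) *v u' + (g2 (u t) - g1 (u t))) (at t within T)"
proof -
  have "((\<lambda>t. linear_homotopy g1 g2 t (u t)) has_vector_derivative
      ((1 - t) *\<^sub>R (jac g1 (u t) *v u') + (- 1) *\<^sub>R g1 (u t)) +
      (t *\<^sub>R (jac g2 (u t) *v u') + 1 *\<^sub>R g2 (u t))) (at t within T)"
    unfolding linear_homotopy_def
    by (intro has_vector_derivative_add has_vector_derivative_scaleR
        has_vector_derivative_along_curve assms)
      (auto intro!: derivative_eq_intros)
  then show ?thesis
    by (simp add: linear_homotopy_def matrix_vector_mult_add_rdistrib scaleR_matrix_vector_assoc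
        algebra_simps)
qed

locale kuo_homotopy =
  fixes \<Sigma> :: "(real^'n) set" and g1 g2 :: "real^'n \<Rightarrow> real^'p" and r :: nat and \<rho> K w :: real
  assumes closed_\<Sigma>: "closed \<Sigma>" and zero_\<Sigma>: "0 \<in> \<Sigma>" and r: "r \<ge> 1"
    and radius: "0 < \<rho>" "\<rho> \<le> 1" and w: "0 < w" and K: "0 \<le> K"
    and differentiable: "\<And>x. x \<in> cball 0 \<rho> \<Longrightarrow> g1 differentiable at x"
      "\<And>x. x \<in> cball 0 \<rho> \<Longrightarrow> g2 differentiable at x"
    and lipschitzian_maps: "lipschitzian_on (cball 0 \<rho>) g1" "lipschitzian_on (cball 0 \<rho>) g2"
    and lipschitzian_jacs: "lipschitzian_on (cball 0 \<rho>) (jac g1)" "lipschitzian_on (cball 0 \<rho>) (jac g2)"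
    and flat: "\<And>x. x \<in> cball 0 \<rho> \<Longrightarrow> norm (g2 x - g1 x) \<le> K * infdist x \<Sigma> ^ Suc r"
    and nondegenerate: "\<And>t x v. \<lbrakk>t \<in> {0..1}; x \<in> cball 0 \<rho>;
        x \<in> horn \<Sigma> (Suc r) (linear_homotopy g1 g2 t) w\<rbrakk> \<Longrightarrow>
        infdist x \<Sigma> ^ r * norm v \<le> norm (v v* linear_homotopy (jac g1) (jac g2) t x)"
begin

abbreviation "F \<equiv> linear_homotopy g1 g2"
abbreviation "A \<equiv> linear_homotopy (jac g1) (jac g2)"

definition \<mu> :: "real \<Rightarrow> real^'n \<Rightarrow> real^'p" where
  "\<mu> t x = multiplier (A t x) (norm (F t x)) (g2 x - g1 x)"

definition X :: "real \<Rightarrow> real^'n \<Rightarrow> real^'n" where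
  "X t x = - (\<mu> t x v* A t x)"

definition coercivity :: "real \<Rightarrow> real" where
  "coercivity \<epsilon> = min ((\<epsilon> ^ r)\<^sup>2) (w * \<epsilon> ^ Suc r)"

lemma coercivity_pos: "0 < \<epsilon> \<Longrightarrow> 0 < coercivity \<epsilon>"
  using w by (simp add: coercivity_def)

text \<open>On the horn the Kuo estimate controls the first summand, off the horn the second one is large.\<close>
lemma coercive:
  assumes t: "t \<in> {0..1}" and x: "x \<in> cball 0 \<rho>" and "0 < \<epsilon>" and far: "\<epsilon> \<le> infdist x \<Sigma>"
  shows "coercivity \<epsilon> * (norm v)\<^sup>2 \<le> (norm (v v* A t x))\<^sup>2 + norm (F t x) * (norm v)\<^sup>2"
proof (cases "x \<in> horn \<Sigma> (Suc r) (F t) w")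
  case True
  have "\<epsilon> ^ r * norm v \<le> infdist x \<Sigma> ^ r * norm v"
    using far \<open>0 < \<epsilon>\<close> by (intro mult_right_mono power_mono) auto
  also have "\<dots> \<le> norm (v v* A t x)"
    by (rule nondegenerate[OF t x True])
  finally have "(\<epsilon> ^ r * norm v)\<^sup>2 \<le> (norm (v v* A t x))\<^sup>2"
    using \<open>0 < \<epsilon>\<close> by (intro power_mono) auto
  moreover have "coercivity \<epsilon> * (norm v)\<^sup>2 \<le> (\<epsilon> ^ r)\<^sup>2 * (norm v)\<^sup>2"
    by (intro mult_right_mono) (auto simp: coercivity_def)
  moreover have "0 \<le> norm (F t x) * (norm v)\<^sup>2"
    by simp
  ultimately show ?thesis
    unfolding power_mult_distrib by linarith
next
  case False
  have "w * \<epsilon> ^ Suc r \<le> w * infdist x \<Sigma> ^ Suc r"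
    using far \<open>0 < \<epsilon>\<close> w by (intro mult_left_mono power_mono) auto
  with False have "coercivity \<epsilon> \<le> norm (F t x)"
    by (auto simp: coercivity_def horn_def)
  then have "coercivity \<epsilon> * (norm v)\<^sup>2 \<le> norm (F t x) * (norm v)\<^sup>2"
    by (rule mult_right_mono) simp
  then show ?thesis
    using zero_le_power2[of "norm (v v* A t x)"] by linarith
qed

lemma norm_X_le_on_horn:
  assumes t: "t \<in> {0..1}" and x: "x \<in> cball 0 \<rho>" and d: "0 < infdist x \<Sigma>"
    and horn: "x \<in> horn \<Sigma> (Suc r) (F t) w"
  shows "norm (X t x) \<le> K * infdist x \<Sigma>"
proof -
  have "infdist x \<Sigma> ^ r * norm (X t x) \<le> norm (g2 x - g1 x)"
    using norm_multiplier_mult_le_if_bounded_below[OF coercivity_pos[OF d]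
        coercive[OF t x d order_refl] norm_ge_zero _ nondegenerate[OF t x horn]] d
    by (simp add: X_def \<mu>_def)
  also have "\<dots> \<le> infdist x \<Sigma> ^ r * (K * infdist x \<Sigma>)"
    using flat[OF x] by (simp add: mult_ac)
  finally show ?thesis
    using d by (simp add: mult_le_cancel_left)
qed

lemma norm_X_le_off_horn:
  assumes t: "t \<in> {0..1}" and x: "x \<in> cball 0 \<rho>" and d: "0 < infdist x \<Sigma>"
    and horn: "x \<notin> horn \<Sigma> (Suc r) (F t) w"
  shows "w * (norm (X t x))\<^sup>2 \<le> (K * infdist x \<Sigma>)\<^sup>2"
proof -
  let ?d = "infdist x \<Sigma>"
  have F: "w * ?d ^ Suc r < norm (F t x)"
    using horn by (simp add: horn_def)
  moreover have "0 < w * ?d ^ Suc r"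
    using w d by simp
  ultimately have "0 < norm (F t x)"
    by linarith
  have "?d ^ Suc r * (w * (norm (X t x))\<^sup>2) \<le> norm (F t x) * (norm (X t x))\<^sup>2"
    using mult_right_mono[OF less_imp_le[OF F], of "(norm (X t x))\<^sup>2"] by (simp add: mult_ac)
  also have "\<dots> \<le> (norm (g2 x - g1 x))\<^sup>2"
    using norm_multiplier_mult_le_if_regularized[OF coercivity_pos[OF d]
        coercive[OF t x d order_refl] \<open>0 < norm (F t x)\<close>]
    by (simp add: X_def \<mu>_def)
  also have "\<dots> \<le> (K * ?d ^ Suc r)\<^sup>2"
    by (intro power_mono flat[OF x]) simp
  also have "\<dots> = ?d ^ Suc r * (K\<^sup>2 * ?d ^ Suc r)"
    by (simp add: power2_eq_square mult_ac)
  finally have "w * (norm (X t x))\<^sup>2 \<le> K\<^sup>2 * ?d ^ Suc r"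
    using d by (simp add: mult_le_cancel_left)
  also have "\<dots> \<le> K\<^sup>2 * ?d\<^sup>2"
  proof -
    have "?d \<le> 1"
      using infdist_le_norm[OF zero_\<Sigma>, of x] x radius by simp
    then show ?thesis
      using r d by (intro mult_left_mono power_decreasing) auto
  qed
  finally show ?thesis
    by (simp add: power_mult_distrib)
qed

lemma norm_X_le:
  assumes t: "t \<in> {0..1}" and x: "x \<in> cball 0 \<rho>"
  shows "norm (X t x) \<le> (K + K / w) * infdist x \<Sigma>"
proof (cases "infdist x \<Sigma> = 0")
  case True
  then have "g2 x - g1 x = 0"
    using flat[OF x] by simp
  then show ?thesis
    using True by (simp add: X_def \<mu>_def multiplier_def)
next
  case False
  then have d: "0 < infdist x \<Sigma>"
    using infdist_nonneg[of x \<Sigma>] by linarith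
  show ?thesis
  proof (cases "x \<in> horn \<Sigma> (Suc r) (F t) w")
    case True
    then show ?thesis
      using norm_X_le_on_horn[OF t x d] K w d by (simp add: distrib_right add_increasing2)
  next
    case False
    have "(norm (X t x))\<^sup>2 \<le> K\<^sup>2 / w * (infdist x \<Sigma>)\<^sup>2"
      using norm_X_le_off_horn[OF t x d False] w by (simp add: field_simps power_mult_distrib)
    also have "\<dots> \<le> (K + K / w)\<^sup>2 * (infdist x \<Sigma>)\<^sup>2"
    proof (rule mult_right_mono)
      have "K * (K / w) \<le> (K + K / w) * (K + K / w)"
        using K w by (intro mult_mono) auto
      then show "K\<^sup>2 / w \<le> (K + K / w)\<^sup>2"
        by (simp add: power2_eq_square)
    qed simp
    finally have "(norm (X t x))\<^sup>2 \<le> ((K + K / w) * infdist x \<Sigma>)\<^sup>2"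
      by (simp add: power_mult_distrib)
    then show ?thesis
      by (rule power2_le_imp_le) (use K w d in simp)
  qed
qed

lemma lipschitzian_on_X:
  assumes "0 < \<epsilon>"
  shows "lipschitzian_on ({0..1} \<times> {x \<in> cball 0 \<rho>. \<epsilon> \<le> infdist x \<Sigma>}) (\<lambda>p. X (fst p) (snd p))"
proof -
  let ?B = "{x \<in> cball 0 \<rho>. \<epsilon> \<le> infdist x \<Sigma>}"
  have "bounded ?B"
    by (rule bounded_subset[OF bounded_cball[of 0 \<rho>]]) auto
  then have "bounded ({0..1::real} \<times> ?B)"
    by (intro bounded_Times) auto
  have "?B \<subseteq> cball 0 \<rho>"
    by auto
  note maps = lipschitzian_maps[THEN lipschitzian_on_subset, OF this]
    and jacs = lipschitzian_jacs[THEN lipschitzian_on_subset, OF this]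
  have A: "lipschitzian_on ({0..1} \<times> ?B) (\<lambda>p. A (fst p) (snd p))"
    by (intro lipschitzian_on_linear_homotopy jacs \<open>bounded ?B\<close>)
  have F: "lipschitzian_on ({0..1} \<times> ?B) (\<lambda>p. norm (F (fst p) (snd p)))"
    by (intro lipschitzian_on_norm lipschitzian_on_linear_homotopy maps \<open>bounded ?B\<close>)
  have "lipschitzian_on ?B (\<lambda>x. g2 x - g1 x)"
    by (intro lipschitzian_on_diff maps)
  then have P: "lipschitzian_on ({0..1::real} \<times> ?B) (\<lambda>p. g2 (snd p) - g1 (snd p))"
    by (rule lipschitzian_on_compose[OF _ lipschitzian_on_snd]) auto
  have "lipschitzian_on ({0..1} \<times> ?B) (\<lambda>p. \<mu> (fst p) (snd p))"
    unfolding \<mu>_def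
    by (rule lipschitzian_on_multiplier[OF A F P \<open>bounded ({0..1} \<times> ?B)\<close> coercivity_pos[OF assms]])
      (auto intro!: coercive assms)
  then show ?thesis
    unfolding X_def
    by (intro lipschitzian_on_minus A \<open>bounded ({0..1} \<times> ?B)\<close>
        bounded_bilinear.lipschitzian_on[OF bounded_bilinear_vector_matrix_mult])
qed

sublocale vanishing_field \<Sigma> X \<rho> "K + K / w"
  by standard (use closed_\<Sigma> zero_\<Sigma> radius K w norm_X_le lipschitzian_on_X in auto)

lemma homotopy_along_integral_curve:
  assumes u: "integral_curve X (cball 0 \<rho>) u" and t: "t \<in> {0..1}" and off: "u t \<notin> \<Sigma>"
  shows "((\<lambda>t. F t (u t)) has_vector_derivative norm (F t (u t)) *\<^sub>R \<mu> t (u t)) (at t within {0..1})"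
proof -
  note ut = integral_curveD(1)[OF u t] and d = infdist_pos[OF off]
  have "A t (u t) *v (\<mu> t (u t) v* A t (u t)) + norm (F t (u t)) *\<^sub>R \<mu> t (u t) = g2 (u t) - g1 (u t)"
    unfolding \<mu>_def by (rule multiplier_eq[OF coercivity_pos[OF d] coercive[OF t ut d order_refl]])
  then have "A t (u t) *v X t (u t) + (g2 (u t) - g1 (u t)) = norm (F t (u t)) *\<^sub>R \<mu> t (u t)"
    unfolding X_def
    by (simp add: bounded_bilinear.minus_right[OF bounded_bilinear_matrix_vector_mult] algebra_simps)
  with has_vector_derivative_linear_homotopy[OF differentiable(1)[OF ut] differentiable(2)[OF ut]
      integral_curveD(2)[OF u t]]
  show ?thesis
    by simp
qed

lemma norm_\<mu>_le:
  assumes t: "t \<in> {0..1}" and x: "x \<in> cball 0 \<rho>" and "0 < \<epsilon>" "\<epsilon> \<le> infdist x \<Sigma>"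
  shows "norm (\<mu> t x) \<le> K / coercivity \<epsilon>"
proof -
  have "infdist x \<Sigma> ^ Suc r \<le> 1"
    using infdist_le_norm[OF zero_\<Sigma>, of x] x radius by (intro power_le_one) (auto simp: infdist_nonneg)
  then have "norm (g2 x - g1 x) \<le> K"
    using flat[OF x] mult_left_mono[OF _ K, of "infdist x \<Sigma> ^ Suc r" 1] by linarith
  moreover have "coercivity \<epsilon> * norm (\<mu> t x) \<le> norm (g2 x - g1 x)"
    unfolding \<mu>_def by (rule norm_multiplier_le[OF coercivity_pos coercive]) (use assms in auto)
  ultimately show ?thesis
    using coercivity_pos[OF \<open>0 < \<epsilon>\<close>] by (simp add: field_simps)
qed

lemma integral_curves_carry_zeros:
  assumes u: "integral_curve X (cball 0 \<rho>) u"
  shows "g1 (u 0) = 0 \<longleftrightarrow> g2 (u 1) = 0"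
proof (cases "u 0 \<in> \<Sigma>")
  case True
  then have "u 1 = u 0"
    using integral_curve_const[OF u, of 0 1] by simp
  moreover have "g2 (u 0) = g1 (u 0)"
    using flat[OF integral_curveD(1)[OF u, of 0]] True by simp
  ultimately show ?thesis
    by simp
next
  case False
  define \<epsilon> where "\<epsilon> = exp (- (K + K / w)) * infdist (u 0) \<Sigma>"
  have "0 < \<epsilon>"
    using infdist_pos[OF False] by (simp add: \<epsilon>_def)
  have far: "\<epsilon> \<le> infdist (u t) \<Sigma>" if "t \<in> {0..1}" for t
    using infdist_integral_curve_le[OF u that, of 0] unfolding \<epsilon>_def exp_minus_mult_le_iff by simp
  have "u t \<notin> \<Sigma>" if "t \<in> {0..1}" for t
    using far[OF that] \<open>0 < \<epsilon>\<close> by auto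
  then have deriv: "((\<lambda>t. F t (u t)) has_vector_derivative norm (F t (u t)) *\<^sub>R \<mu> t (u t))
      (at t within {0..1})" if "t \<in> {0..1}" for t
    using homotopy_along_integral_curve[OF u that] that by blast
  have bound: "norm (norm (F t (u t)) *\<^sub>R \<mu> t (u t)) \<le> K / coercivity \<epsilon> * norm (F t (u t))"
    if t: "t \<in> {0..1}" for t
    using mult_left_mono[OF norm_\<mu>_le[OF t integral_curveD(1)[OF u t] \<open>0 < \<epsilon>\<close> far[OF t]]
        norm_ge_zero[of "F t (u t)"]]
    by (simp add: mult.commute)
  have "F 0 (u 0) = 0 \<longleftrightarrow> F 1 (u 1) = 0"
    using gronwall_norm[where u = "\<lambda>t. F t (u t)", OF deriv bound, of 0 1]
      gronwall_norm[where u = "\<lambda>t. F t (u t)", OF deriv bound, of 1 0] by auto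
  then show ?thesis
    by simp
qed

lemma sigma_V_equiv: "sigma_V_equiv \<Sigma> g1 g2"
  by (rule sigma_V_equiv_if_curves_carry_zeros[OF integral_curves_carry_zeros])

end

context realisation_pair
begin

lemma kuo_homotopy_near_0:
  obtains \<rho> K w where "kuo_homotopy \<Sigma> g1 g2 r \<rho> K w"
proof -
  obtain K where "K \<ge> 0" and flat: "\<forall>\<^sub>F x in nhds 0. norm (g2 x - g1 x) \<le> K * infdist x \<Sigma> ^ Suc r"
    by (rule flat_near_0)
  obtain \<epsilon> where "\<epsilon> > 0" and horn: "\<And>t. t \<in> {0..1} \<Longrightarrow> nondegenerate_on_horn \<Sigma> r (F t) (A t) \<epsilon>"
    using nondegenerate_uniformly by blast
  obtain s where s: "r = Suc s"
    using r by (cases r) auto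
  have small: "\<forall>\<^sub>F \<rho> in at_right 0. 0 < \<rho> \<and> \<rho> < min 1 \<epsilon>"
    using \<open>\<epsilon> > 0\<close> eventually_at_right_real[of 0 "min 1 \<epsilon>"] by simp
  have pointwise: "\<forall>\<^sub>F \<rho> in at_right 0. \<forall>x\<in>cball 0 \<rho>. g1 differentiable at x \<and> g2 differentiable at x \<and>
      norm (g2 x - g1 x) \<le> K * infdist x \<Sigma> ^ Suc r"
    by (intro eventually_nhds_imp_eventually_cball eventually_conj flat
        germ_Cs_differentiable[OF germ_g1] germ_Cs_differentiable[OF germ_g2])
  have lipschitzian: "\<forall>\<^sub>F \<rho> in at_right 0.
      lipschitzian_on (cball 0 \<rho>) g1 \<and> lipschitzian_on (cball 0 \<rho>) g2 \<and>
      lipschitzian_on (cball 0 \<rho>) (jac g1) \<and> lipschitzian_on (cball 0 \<rho>) (jac g2)"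
    using germ_g1 germ_g2 unfolding s
    by (intro eventually_conj germ_Cs_lipschitzian_on germ_Cs_lipschitzian_on_jac)
  obtain \<rho> where \<rho>: "0 < \<rho>" "\<rho> < min 1 \<epsilon>"
    and near_0: "\<And>x. x \<in> cball 0 \<rho> \<Longrightarrow> g1 differentiable at x \<and> g2 differentiable at x \<and>
      norm (g2 x - g1 x) \<le> K * infdist x \<Sigma> ^ Suc r"
    and lip: "lipschitzian_on (cball 0 \<rho>) g1" "lipschitzian_on (cball 0 \<rho>) g2"
      "lipschitzian_on (cball 0 \<rho>) (jac g1)" "lipschitzian_on (cball 0 \<rho>) (jac g2)"
    using eventually_happens'[OF trivial_limit_at_right_real
        eventually_conj[OF small eventually_conj[OF pointwise lipschitzian]]] by auto
  have "kuo_homotopy \<Sigma> g1 g2 r \<rho> K \<epsilon>"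
  proof
    show "infdist x \<Sigma> ^ r * norm v \<le> norm (v v* A t x)"
      if "t \<in> {0..1}" "x \<in> cball 0 \<rho>" "x \<in> horn \<Sigma> (Suc r) (F t) \<epsilon>" for t x v
      using horn[OF that(1)] that(2,3) \<rho>(2) unfolding nondegenerate_on_horn_def by auto
  qed (use closed zero r \<rho> \<open>\<epsilon> > 0\<close> \<open>K \<ge> 0\<close> near_0 lip in auto)
  then show ?thesis
    by (rule that)
qed

lemma sigma_V_equiv: "sigma_V_equiv \<Sigma> g1 g2"
  using kuo_homotopy_near_0 kuo_homotopy.sigma_V_equiv by metis

end

theorem theorem5p9:
  fixes \<Sigma> :: "(real^'n) set" and f :: "real^'n \<Rightarrow> real^'p" and r :: nat
  assumes "closed \<Sigma>" and "0 \<in> \<Sigma>" and "r \<ge> 1"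
    and "CARD('n) \<ge> CARD('p)"
    and "germ_Cs (Suc r) f"
    and "rel_kuo_delta \<Sigma> r f"
  shows "sigma_V_sufficient \<Sigma> r (Suc r) f"
  unfolding sigma_V_sufficient_def
proof (intro allI impI, elim conjE)
  fix g1 g2
  assume "germ_Cs (Suc r) g1" "rel_jet_eq r \<Sigma> g1 f" "germ_Cs (Suc r) g2" "rel_jet_eq r \<Sigma> g2 f"
  with assms interpret realisation_pair \<Sigma> r f g1 g2
    by unfold_locales
  show "sigma_V_equiv \<Sigma> g1 g2"
    by (rule sigma_V_equiv)
qed

end
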